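(* Let $\mu,L>0$ and $C_0\ge 0$ be such that: (i) the local costs $f_i:\mathbb{R}^n\times\mathbb{R}_+\to\mathbb{R}$ belong to $\mathcal{S}_{\mu,L}(\mathbb{R}^n)$ uniformly in $t$; (ii) $\|\nabla_{tx_i}f_i(x_i;t)\|\le C_0$ for all $x_i\in\mathbb{R}^n$, $t\in\mathbb{R}_+$ and all $i$; (iii) the solution of the problem $\min_{x,y}\{f(x;t_k)+\iota_{\ker(I-P)}(y)\}$ subject to $Ax-y=0$ is finite for every $k\in\mathbb{N}$. For each $k$ let $w^*(t_k)$ be a solution of the original dual problem, and assume that there is a constant $C$ with $\max\{\|w^*(t_k)\|,\|w^*(\epsilon;t_k)\|\}\le C$ for every $k$ and every regularization parameter $\epsilon>0$ considered. Then there exists $\psi_0>0$ such that, for all small enough $\epsilon>0$, the following holds. Let $\rho>0$, let $N_P,N_C$ be such that $$\eta_1(\epsilon):=\zeta(N_C;\epsilon)\big[\zeta(N_P;\epsilon)+2\bar\kappa(\epsilon)\,\xi(N_P;\epsilon)\big]<1,$$ and let $\{w_k\}_{k\in\mathbb{N}}$ be the sequence of dual variables generated by the prediction-correction dual-regularized ADMM with parameters $\epsilon,\rho$ and horizons $N_P,N_C$. Then $\{w_k\}$ converges to a neighborhood of the original solution $\{w^*(t_k)\}$ with $$\limsup_{k\to\infty}\|w_k-w^*(t_k)\|\le\frac{\eta_0(\epsilon)}{1-\eta_1(\epsilon)}+C(1+\psi_0\epsilon),$$ where $$\eta_0(\epsilon):=\zeta(N_C;\epsilon)\,\frac{\bar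 C_0T_s}{\bar\mu(\epsilon)}\big[\zeta(N_P;\epsilon)+2(1+\bar\kappa(\epsilon)\,\xi(N_P;\epsilon))\big].$$
   Context: Setting. $\mathcal{G}=(\mathcal{V},\mathcal{E})$ is an undirected connected graph with $N$ nodes; $\mathcal{N}_i$ is the neighborhood of node $i$, $d_i=|\mathcal{N}_i|$, $d_M=\max_i d_i$. Node $i$ holds a time-varying cost $f_i(x_i;t)$. Sampling times $t_k$, $k\in\mathbb{N}$, satisfy $t_{k+1}-t_k=T_s>0$; write $f_{i,k}=f_i(\cdot;t_k)$. For $x=(x_1,\dots,x_N)\in\mathbb{R}^{nN}$, $f(x;t)=\sum_i f_i(x_i;t)$. $\mathcal{S}_{\mu,L}(\mathbb{R}^m)$ is the class of $\mu$-strongly convex functions on $\mathbb{R}^m$ with $L$-Lipschitz gradient; "uniformly in $t$" means with constants independent of $t$. The derivatives used below ($\nabla_{x_i}f_i$, Hessian $\nabla_{x_ix_i}f_i$, and $\nabla_{tx_i}f_i$, the time derivative of $\nabla_{x_i}f_i$) exist. Vectors $w,y,z\in\mathbb{R}^{2n|\mathcal{E}|}$ have blocks indexed by ordered pairs $(i,j)$ of adjacent nodes, each in $\mathbb{R}^n$. $A$ is the matrix with $(Ax)_{ij}=x_i$; $P$ is the permutation matrix with $(Py)_{ij}=y_{ji}$; $\iota_{\mathbb{X}}$ is the indicator function of $\mathbb{X}$ ($0$ on $\mathbb{X}$, $+\infty$ elsewhere); $h=\iota_{\ker(I-P)}$. Convex conjugate: $g^\star(w)=\sup_x\{\langle w,x\rangle-g(x)\}$.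 The original dual problem at $t_k$ is $\min_w\{f^\star(A^\top w;t_k)+h^\star(-w)\}$. The regularized dual solution is $w^*(\epsilon;t_k)=\arg\min_w\{\frac{\epsilon}{2}\|w\|^2+f^\star(A^\top w;t_k)+h^\star(-w)\}$. Constants. $\bar\mu(\epsilon)=\epsilon$, $\bar L(\epsilon)=\epsilon+d_M/\mu$, $\bar\kappa(\epsilon)=\bar L(\epsilon)/\bar\mu(\epsilon)=1+d_M/(\mu\epsilon)$, $\bar C_0=\sqrt{d_M}\,C_0/\mu$, $$\lambda(\epsilon)=\max\left\{\left|\frac{1-\rho\bar L(\epsilon)}{1+\rho\bar L(\epsilon)}\right|,\left|\frac{1-\rho\bar\mu(\epsilon)}{1+\rho\bar\mu(\epsilon)}\right|\right\},\qquad \omega(\epsilon)=\frac{1+\rho\bar L(\epsilon)}{1+\rho\bar\mu(\epsilon)}.$$ $\zeta(0;\epsilon)=1$ and $\zeta(\ell;\epsilon)=\omega(\epsilon)\lambda(\epsilon)^\ell$ for $\ell\ge1$; $\xi(0;\epsilon)=0$ and $\xi(\ell;\epsilon)=1+\omega(\epsilon)\lambda(\epsilon)^\ell$ for $\ell\ge1$. Algorithm. Let $\delta=1/(1+\epsilon\rho)$. Given local costs $g_1,\dots,g_N$ and $z$, define for each $i$ $$x_i(z;g)=\arg\min_{x_i\in\mathbb{R}^n}\Big\{g_i(x_i)+\frac{\rho\delta d_i}{2}\|x_i\|^2-\delta\big\langle x_i,\sum_{j\in\mathcal{N}_i}z_{ij}\big\rangle\Big\}.$$ One step of the distributed dual-regularized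 ADMM with costs $g$ replaces $z$ by $z^+$ with $z^+_{ij}=(1-2\delta)z_{ji}+2\delta\rho\,x_j(z;g)$. The horizons $N_P,N_C$ are nonnegative integers. Start from a given $x_0=(x_{1,0},\dots,x_{N,0})$ and $z_0=0$. For $k=0,1,\dots$: (prediction) let $\hat f_{i,k+1}$ be the quadratic function with gradient $\nabla\hat f_{i,k+1}(x_i)=\nabla_{x_i}f_{i,k}(x_{i,k})+\nabla_{x_ix_i}f_{i,k}(x_{i,k})(x_i-x_{i,k})+T_s\nabla_{tx_i}f_{i,k}(x_{i,k})$; apply $N_P$ ADMM steps with costs $\hat f_{i,k+1}$ starting from $z_k$, obtaining $\hat z_{k+1}$; (correction) apply $N_C$ ADMM steps with costs $f_{i,k+1}$ starting from $\hat z_{k+1}$, obtaining $z_{k+1}$, and set $x_{i,k+1}=x_i(z_{k+1};f_{\cdot,k+1})$. The generated dual variables are $w_{ij,k}=\delta(z_{ij,k}-\rho x_{i,k})$, i.e. $w_k=\delta(z_k-\rho Ax_k)$. *)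

theory Defs
  imports "HOL-Analysis.Analysis" "Graph_Theory.Digraph_Component"
begin

section \<open>Convex functions\<close>

definition strongly_convex :: "real \<Rightarrow> ('a::real_inner \<Rightarrow> real) \<Rightarrow> bool" where
  "strongly_convex \<mu> g \<longleftrightarrow> convex_on UNIV (\<lambda>x. g x - \<mu> / 2 * (norm x)\<^sup>2)"

definition S_class :: "real \<Rightarrow> real \<Rightarrow> ('a::real_inner \<Rightarrow> real) set" where
  "S_class \<mu> L = {g. strongly_convex \<mu> g \<and>
     (\<exists>g'. (\<forall>x. GDERIV g x :> g' x) \<and> L-lipschitz_on UNIV g')}"

definition convex_conjugate :: "('a::real_inner \<Rightarrow> ereal) \<Rightarrow> 'a \<Rightarrow> ereal" where
  "convex_conjugate g w = (SUP x. ereal (w \<bullet> x) - g x)"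

definition set_indicator :: "'a set \<Rightarrow> 'a \<Rightarrow> ereal" where
  "set_indicator X x = (if x \<in> X then 0 else \<infinity>)"


section \<open>Graph and edge vectors\<close>

text \<open>
  The graph is a \<open>pair_graph\<close> whose vertex set is the whole finite type \<open>'v\<close>; since it is
  symmetric and loop-free, \<open>parcs G\<close> is the set of ordered pairs of adjacent nodes.
  A family of blocks in \<open>real^'n\<close> indexed by \<open>parcs G\<close> is represented by a vector indexed by all
  pairs of nodes that vanishes off \<open>parcs G\<close>. This makes \<open>edge_space G\<close> an isometric copy
  of the Euclidean space of such families.
\<close>

definition edge_space :: "'v::finite pair_pre_digraph \<Rightarrow> (real^'n^('v \<times> 'v)) set" where
  "edge_space G = {w. \<forall>e. e \<notin> parcs G \<longrightarrow> w $ e = 0}"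

definition nbhd :: "'v pair_pre_digraph \<Rightarrow> 'v \<Rightarrow> 'v set" where
  "nbhd G i = {j. (i, j) \<in> parcs G}"

definition node_degree :: "'v pair_pre_digraph \<Rightarrow> 'v \<Rightarrow> nat" where
  "node_degree G i = card (nbhd G i)"

definition max_degree :: "'v::finite pair_pre_digraph \<Rightarrow> nat" where
  "max_degree G = Max (range (node_degree G))"

definition A_map :: "'v::finite pair_pre_digraph \<Rightarrow> real^'n^'v \<Rightarrow> real^'n^('v \<times> 'v)" where
  "A_map G x = (\<chi> e. if e \<in> parcs G then x $ fst e else 0)"

definition P_map :: "real^'n^('v::finite \<times> 'v) \<Rightarrow> real^'n^('v \<times> 'v)" where
  "P_map y = (\<chi> e. y $ (snd e, fst e))"

definition ker_I_minus_P :: "'v::finite pair_pre_digraph \<Rightarrow> (real^'n^('v \<times> 'v)) set" where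
  "ker_I_minus_P G = {y \<in> edge_space G. y - P_map y = 0}"

definition h_fun :: "'v::finite pair_pre_digraph \<Rightarrow> real^'n^('v \<times> 'v) \<Rightarrow> ereal" where
  "h_fun G = set_indicator (ker_I_minus_P G)"


section \<open>Primal problem, dual problem and its regularization\<close>

definition total_cost :: "('v::finite \<Rightarrow> real^'n \<Rightarrow> real \<Rightarrow> real) \<Rightarrow> real \<Rightarrow> real^'n^'v \<Rightarrow> real" where
  "total_cost f t x = (\<Sum>i\<in>UNIV. f i (x $ i) t)"

definition primal_obj ::
  "'v::finite pair_pre_digraph \<Rightarrow> ('v \<Rightarrow> real^'n \<Rightarrow> real \<Rightarrow> real) \<Rightarrow> real
    \<Rightarrow> (real^'n^'v) \<times> (real^'n^('v \<times> 'v)) \<Rightarrow> ereal" where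
  "primal_obj G f t = (\<lambda>(x, y). ereal (total_cost f t x) + set_indicator (ker_I_minus_P G) y)"

definition primal_solution ::
  "'v::finite pair_pre_digraph \<Rightarrow> ('v \<Rightarrow> real^'n \<Rightarrow> real \<Rightarrow> real) \<Rightarrow> real
    \<Rightarrow> (real^'n^'v) \<times> (real^'n^('v \<times> 'v)) \<Rightarrow> bool" where
  "primal_solution G f t =
     is_arg_min (primal_obj G f t) (\<lambda>(x, y). y \<in> edge_space G \<and> A_map G x - y = 0)"

text \<open>
  The library's \<open>adjoint\<close> of \<open>A_map G\<close>, taken in the ambient space, agrees with the transpose of
  \<open>A\<close> on \<open>edge_space G\<close>. Likewise \<open>h_fun G\<close> is infinite off \<open>edge_space G\<close>, so the supremum in
  its conjugate effectively ranges over \<open>edge_space G\<close>.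
\<close>

definition dual_obj ::
  "'v::finite pair_pre_digraph \<Rightarrow> ('v \<Rightarrow> real^'n \<Rightarrow> real \<Rightarrow> real) \<Rightarrow> real
    \<Rightarrow> real^'n^('v \<times> 'v) \<Rightarrow> ereal" where
  "dual_obj G f t w =
     convex_conjugate (\<lambda>x. ereal (total_cost f t x)) (adjoint (A_map G) w)
     + convex_conjugate (h_fun G) (- w)"

definition dual_solution ::
  "'v::finite pair_pre_digraph \<Rightarrow> ('v \<Rightarrow> real^'n \<Rightarrow> real \<Rightarrow> real) \<Rightarrow> real
    \<Rightarrow> real^'n^('v \<times> 'v) \<Rightarrow> bool" where
  "dual_solution G f t = is_arg_min (dual_obj G f t) (\<lambda>w. w \<in> edge_space G)"

definition reg_dual_solution ::
  "'v::finite pair_pre_digraph \<Rightarrow> ('v \<Rightarrow> real^'n \<Rightarrow> real \<Rightarrow> real) \<Rightarrow> real \<Rightarrow> real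
    \<Rightarrow> real^'n^('v \<times> 'v)" where
  "reg_dual_solution G f \<epsilon> t =
     arg_min (\<lambda>w. ereal (\<epsilon> / 2 * (norm w)\<^sup>2) + dual_obj G f t w) (\<lambda>w. w \<in> edge_space G)"


section \<open>Constants\<close>

definition mu_bar :: "real \<Rightarrow> real" where
  "mu_bar \<epsilon> = \<epsilon>"

definition L_bar :: "nat \<Rightarrow> real \<Rightarrow> real \<Rightarrow> real" where
  "L_bar dM \<mu> \<epsilon> = \<epsilon> + real dM / \<mu>"

definition kappa_bar :: "nat \<Rightarrow> real \<Rightarrow> real \<Rightarrow> real" where
  "kappa_bar dM \<mu> \<epsilon> = L_bar dM \<mu> \<epsilon> / mu_bar \<epsilon>"

definition C0_bar :: "nat \<Rightarrow> real \<Rightarrow> real \<Rightarrow> real" where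
  "C0_bar dM \<mu> C\<^sub>0 = sqrt (real dM) * C\<^sub>0 / \<mu>"

definition lambda_rate :: "nat \<Rightarrow> real \<Rightarrow> real \<Rightarrow> real \<Rightarrow> real" where
  "lambda_rate dM \<mu> \<rho> \<epsilon> =
     max \<bar>(1 - \<rho> * L_bar dM \<mu> \<epsilon>) / (1 + \<rho> * L_bar dM \<mu> \<epsilon>)\<bar>
         \<bar>(1 - \<rho> * mu_bar \<epsilon>) / (1 + \<rho> * mu_bar \<epsilon>)\<bar>"

definition omega :: "nat \<Rightarrow> real \<Rightarrow> real \<Rightarrow> real \<Rightarrow> real" where
  "omega dM \<mu> \<rho> \<epsilon> = (1 + \<rho> * L_bar dM \<mu> \<epsilon>) / (1 + \<rho> * mu_bar \<epsilon>)"

definition zeta :: "nat \<Rightarrow> real \<Rightarrow> real \<Rightarrow> real \<Rightarrow> nat \<Rightarrow> real" where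
  "zeta dM \<mu> \<rho> \<epsilon> l = (if l = 0 then 1 else omega dM \<mu> \<rho> \<epsilon> * lambda_rate dM \<mu> \<rho> \<epsilon> ^ l)"

definition xi :: "nat \<Rightarrow> real \<Rightarrow> real \<Rightarrow> real \<Rightarrow> nat \<Rightarrow> real" where
  "xi dM \<mu> \<rho> \<epsilon> l = (if l = 0 then 0 else 1 + omega dM \<mu> \<rho> \<epsilon> * lambda_rate dM \<mu> \<rho> \<epsilon> ^ l)"

definition eta1 :: "nat \<Rightarrow> real \<Rightarrow> real \<Rightarrow> nat \<Rightarrow> nat \<Rightarrow> real \<Rightarrow> real" where
  "eta1 dM \<mu> \<rho> N\<^sub>P N\<^sub>C \<epsilon> =
     zeta dM \<mu> \<rho> \<epsilon> N\<^sub>C * (zeta dM \<mu> \<rho> \<epsilon> N\<^sub>P + 2 * kappa_bar dM \<mu> \<epsilon> * xi dM \<mu> \<rho> \<epsilon> N\<^sub>P)"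

definition eta0 :: "nat \<Rightarrow> real \<Rightarrow> real \<Rightarrow> real \<Rightarrow> real \<Rightarrow> nat \<Rightarrow> nat \<Rightarrow> real \<Rightarrow> real" where
  "eta0 dM \<mu> C\<^sub>0 Ts \<rho> N\<^sub>P N\<^sub>C \<epsilon> =
     zeta dM \<mu> \<rho> \<epsilon> N\<^sub>C * (C0_bar dM \<mu> C\<^sub>0 * Ts / mu_bar \<epsilon>)
     * (zeta dM \<mu> \<rho> \<epsilon> N\<^sub>P + 2 * (1 + kappa_bar dM \<mu> \<epsilon> * xi dM \<mu> \<rho> \<epsilon> N\<^sub>P))"


section \<open>The algorithm\<close>

definition delta :: "real \<Rightarrow> real \<Rightarrow> real" where
  "delta \<epsilon> \<rho> = 1 / (1 + \<epsilon> * \<rho>)"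

definition local_argmin ::
  "'v::finite pair_pre_digraph \<Rightarrow> real \<Rightarrow> real \<Rightarrow> ('v \<Rightarrow> real^'n \<Rightarrow> real)
    \<Rightarrow> real^'n^('v \<times> 'v) \<Rightarrow> 'v \<Rightarrow> real^'n" where
  "local_argmin G \<epsilon> \<rho> g z i =
     arg_min (\<lambda>u. g i u + \<rho> * delta \<epsilon> \<rho> * real (node_degree G i) / 2 * (norm u)\<^sup>2
                  - delta \<epsilon> \<rho> * (u \<bullet> (\<Sum>j\<in>nbhd G i. z $ (i, j)))) (\<lambda>_. True)"

definition admm_step ::
  "'v::finite pair_pre_digraph \<Rightarrow> real \<Rightarrow> real \<Rightarrow> ('v \<Rightarrow> real^'n \<Rightarrow> real)
    \<Rightarrow> real^'n^('v \<times> 'v) \<Rightarrow> real^'n^('v \<times> 'v)" where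
  "admm_step G \<epsilon> \<rho> g z =
     (\<chi> e. if e \<in> parcs G
           then (1 - 2 * delta \<epsilon> \<rho>) *\<^sub>R z $ (snd e, fst e)
                + (2 * delta \<epsilon> \<rho> * \<rho>) *\<^sub>R local_argmin G \<epsilon> \<rho> g z (snd e)
           else 0)"

text \<open>
  The predicted costs are pinned down by their affine gradients, hence up to additive constants,
  which do not influence \<open>local_argmin\<close>.
\<close>

definition predicted_costs ::
  "('v::finite \<Rightarrow> real^'n \<Rightarrow> real \<Rightarrow> real^'n) \<Rightarrow> ('v \<Rightarrow> real^'n \<Rightarrow> real \<Rightarrow> real^'n^'n)
    \<Rightarrow> ('v \<Rightarrow> real^'n \<Rightarrow> real \<Rightarrow> real^'n) \<Rightarrow> real \<Rightarrow> real \<Rightarrow> real^'n^'v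
    \<Rightarrow> ('v \<Rightarrow> real^'n \<Rightarrow> real) \<Rightarrow> bool" where
  "predicted_costs grad hess tgrad Ts s x g \<longleftrightarrow>
     (\<forall>i u. GDERIV (g i) u :>
        (grad i (x $ i) s + hess i (x $ i) s *v (u - x $ i) + Ts *\<^sub>R tgrad i (x $ i) s))"

definition pc_dr_admm ::
  "'v::finite pair_pre_digraph \<Rightarrow> ('v \<Rightarrow> real^'n \<Rightarrow> real \<Rightarrow> real)
    \<Rightarrow> ('v \<Rightarrow> real^'n \<Rightarrow> real \<Rightarrow> real^'n) \<Rightarrow> ('v \<Rightarrow> real^'n \<Rightarrow> real \<Rightarrow> real^'n^'n)
    \<Rightarrow> ('v \<Rightarrow> real^'n \<Rightarrow> real \<Rightarrow> real^'n) \<Rightarrow> (nat \<Rightarrow> real) \<Rightarrow> real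
    \<Rightarrow> real \<Rightarrow> real \<Rightarrow> nat \<Rightarrow> nat \<Rightarrow> real^'n^'v
    \<Rightarrow> (nat \<Rightarrow> real^'n^'v) \<Rightarrow> (nat \<Rightarrow> real^'n^('v \<times> 'v)) \<Rightarrow> (nat \<Rightarrow> real^'n^('v \<times> 'v)) \<Rightarrow> bool" where
  "pc_dr_admm G f grad hess tgrad t Ts \<epsilon> \<rho> N\<^sub>P N\<^sub>C x0 x z w \<longleftrightarrow>
     x 0 = x0 \<and> z 0 = 0 \<and>
     (\<forall>k. \<exists>fhat zhat.
        predicted_costs grad hess tgrad Ts (t k) (x k) fhat \<and>
        zhat = (admm_step G \<epsilon> \<rho> fhat ^^ N\<^sub>P) (z k) \<and>
        z (Suc k) = (admm_step G \<epsilon> \<rho> (\<lambda>i u. f i u (t (Suc k))) ^^ N\<^sub>C) zhat \<and>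
        x (Suc k) = (\<chi> i. local_argmin G \<epsilon> \<rho> (\<lambda>i u. f i u (t (Suc k))) (z (Suc k)) i)) \<and>
     (\<forall>k. w k = delta \<epsilon> \<rho> *\<^sub>R (z k - \<rho> *\<^sub>R A_map G (x k)))"

end

theory Submission
  imports Defs
begin

text \<open>
  The ADMM step is Peaceman-Rachford splitting on the regularized dual. With \<open>x = \<nabla>f\<^sup>\<star>(A\<^sup>T w)\<close> the smooth
  part has gradient \<open>\<epsilon> w + A x\<close>, and strong monotonicity of \<open>\<nabla>f\<close> alone makes \<open>w \<mapsto> A x\<close>
  \<open>\<mu>/d\<^sub>M\<close>-cocoercive; so one step contracts the proximal arguments \<open>w + \<rho> (\<epsilon> w + A x)\<close> by
  \<open>\<lambda>(\<epsilon>)\<close>. Banach's theorem gives a fixed point, which is the regularized dual solution by quadratic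
  growth, and the same growth inequality shows \<open>\<parallel>w\<^sup>*(\<epsilon>; t\<^sub>k) - w\<^sup>*(t\<^sub>k)\<parallel> \<le> \<parallel>w\<^sup>*(t\<^sub>k)\<parallel> \<le> C\<close>; hence
  \<open>\<psi>\<^sub>0 = 1\<close> already works.

  Put \<open>c = \<surd>d\<^sub>M C\<^sub>0 T\<^sub>s/\<mu>\<close>. Since \<open>C\<^sub>0\<close> is a bound per node, the drift of the dual gradient between
  samples is only bounded by \<open>\<surd>N c\<close>, while \<open>\<eta>\<^sub>0(\<epsilon>)\<close> contains \<open>c/\<epsilon>\<close> without \<open>\<surd>N\<close>. The extra
  factor is harmless for small \<open>\<epsilon>\<close>: consecutive regularized solutions are at distance at most \<open>2C\<close>,
  and after division by \<open>1 + \<rho> (\<epsilon> + d\<^sub>M/\<mu>)\<close> the drift of \<open>\<rho> A x\<close> is bounded independently of \<open>\<epsilon>\<close>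
  and \<open>\<rho>\<close>, so both are dominated by \<open>c/\<epsilon>\<close>. If \<open>c = 0\<close>, there is no drift.
\<close>

section \<open>Strongly monotone gradients\<close>

text \<open>Predicted costs are specified only through their affine gradients, so strong convexity
  is carried as a property of the gradient. Sampled and predicted costs can then be treated
  alike.\<close>

definition strongly_monotone :: "real \<Rightarrow> ('a::real_inner \<Rightarrow> 'a) \<Rightarrow> bool" where
  "strongly_monotone \<mu> F \<longleftrightarrow> (\<forall>x y. \<mu> * (norm (x - y))\<^sup>2 \<le> (F x - F y) \<bullet> (x - y))"

lemma strongly_monotoneD:
  "strongly_monotone \<mu> F \<Longrightarrow> \<mu> * (norm (x - y))\<^sup>2 \<le> (F x - F y) \<bullet> (x - y)"
  by (simp add: strongly_monotone_def)

lemma GDERIV_along_line: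
  assumes "\<And>u. GDERIV g u :> g' u"
  shows "((\<lambda>s. g (x + s *\<^sub>R v)) has_real_derivative g' (x + s *\<^sub>R v) \<bullet> v) (at s)"
proof -
  have "(g has_derivative (\<lambda>h. h \<bullet> g' (x + s *\<^sub>R v))) (at (x + s *\<^sub>R v))"
    using assms by (simp add: gderiv_def)
  moreover have "((\<lambda>s. x + s *\<^sub>R v) has_derivative (\<lambda>h. h *\<^sub>R v)) (at s)"
    by (auto intro!: derivative_eq_intros)
  ultimately have "((\<lambda>s. g (x + s *\<^sub>R v)) has_derivative (\<lambda>h. (h *\<^sub>R v) \<bullet> g' (x + s *\<^sub>R v))) (at s)"
    by (rule has_derivative_compose[rotated])
  then show ?thesis
    by (simp add: has_field_derivative_def inner_commute mult_commute_abs)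
qed

lemma convex_on_GDERIV_above_tangent:
  fixes h :: "'a::real_inner \<Rightarrow> real"
  assumes "convex_on UNIV h" "\<And>u. GDERIV h u :> h' u"
  shows "h x + h' x \<bullet> (y - x) \<le> h y"
proof -
  define v where "v = y - x"
  have "convex_on UNIV (\<lambda>s. h (x + s *\<^sub>R v))"
  proof (rule convex_onI)
    fix a p q :: real
    assume "0 < a" "a < 1"
    have "x + ((1 - a) *\<^sub>R p + a *\<^sub>R q) *\<^sub>R v
        = (1 - a) *\<^sub>R (x + p *\<^sub>R v) + a *\<^sub>R (x + q *\<^sub>R v)"
      by (simp add: algebra_simps)
    then show "h (x + ((1 - a) *\<^sub>R p + a *\<^sub>R q) *\<^sub>R v)
        \<le> (1 - a) * h (x + p *\<^sub>R v) + a * h (x + q *\<^sub>R v)"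
      using convex_onD[OF assms(1), of a "x + p *\<^sub>R v" "x + q *\<^sub>R v"] \<open>0 < a\<close> \<open>a < 1\<close> by simp
  qed simp
  moreover have "((\<lambda>s. h (x + s *\<^sub>R v)) has_real_derivative h' x \<bullet> v) (at 0 within UNIV)"
    using GDERIV_along_line[of h h' x v 0] assms(2) by simp
  ultimately have "(h' x \<bullet> v) * (1 - 0) \<le> h (x + 1 *\<^sub>R v) - h (x + 0 *\<^sub>R v)"
    by (intro convex_on_imp_above_tangent[where A = UNIV]) auto
  then show ?thesis
    by (simp add: v_def)
qed

lemma GDERIV_norm_power2:
  fixes x :: "'a::real_inner"
  shows "GDERIV (\<lambda>u. c / 2 * (norm u)\<^sup>2) x :> c *\<^sub>R x"
  unfolding gderiv_def power2_norm_eq_inner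
  by (auto intro!: derivative_eq_intros simp: inner_commute algebra_simps)

text \<open>Add the tangent inequalities of the convex function \<open>g - \<mu>/2 |.|^2\<close>
  taken at \<open>x\<close> and at \<open>y\<close>: the function values cancel.\<close>

lemma strongly_convex_imp_strongly_monotone:
  assumes "strongly_convex \<mu> g" "\<And>u. GDERIV g u :> g' u"
  shows "strongly_monotone \<mu> g'"
  unfolding strongly_monotone_def
proof (intro allI)
  fix x y
  define h' where "h' u = g' u - \<mu> *\<^sub>R u" for u
  have h: "convex_on UNIV (\<lambda>u. g u - \<mu> / 2 * (norm u)\<^sup>2)"
    "\<And>u. GDERIV (\<lambda>u. g u - \<mu> / 2 * (norm u)\<^sup>2) u :> h' u"
    unfolding h'_def using assms
    by (simp add: strongly_convex_def, intro GDERIV_diff GDERIV_norm_power2)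
  have "h' x \<bullet> (y - x) + h' y \<bullet> (x - y) \<le> 0"
    using convex_on_GDERIV_above_tangent[OF h, of x y] convex_on_GDERIV_above_tangent[OF h, of y x]
    by simp
  then show "\<mu> * (norm (x - y))\<^sup>2 \<le> (g' x - g' y) \<bullet> (x - y)"
    unfolding h'_def power2_norm_eq_inner by (simp add: inner_simps inner_commute algebra_simps)
qed

lemma strongly_monotone_lower_bound:
  assumes "strongly_monotone \<mu> g'" "\<And>u. GDERIV g u :> g' u"
  shows "g x + g' x \<bullet> (y - x) + \<mu> / 2 * (norm (y - x))\<^sup>2 \<le> g y"
proof -
  define v where "v = y - x"
  \<comment> \<open>Along the segment, \<open>\<phi>\<close> is \<open>g\<close> minus the linear
    and quadratic terms of the claimed bound. Strong monotonicity between \<open>x + s v\<close> and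
    \<open>x\<close>, divided by \<open>s\<close>, makes it nondecreasing.\<close>
  define \<phi> where "\<phi> s = g (x + s *\<^sub>R v) - s * (g' x \<bullet> v) - \<mu> / 2 * (norm v)\<^sup>2 * s\<^sup>2" for s
  have deriv: "(\<phi> has_real_derivative g' (x + s *\<^sub>R v) \<bullet> v - g' x \<bullet> v - \<mu> * (norm v)\<^sup>2 * s) (at s)" for s
    unfolding \<phi>_def
    by (rule derivative_eq_intros GDERIV_along_line assms(2) refl | simp)+
  have nonneg: "0 \<le> g' (x + s *\<^sub>R v) \<bullet> v - g' x \<bullet> v - \<mu> * (norm v)\<^sup>2 * s" if "0 \<le> s" for s
  proof (cases "s = 0")
    case False
    have "s * (\<mu> * (norm v)\<^sup>2 * s) \<le> s * ((g' (x + s *\<^sub>R v) - g' x) \<bullet> v)"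
      using strongly_monotoneD[OF assms(1), of "x + s *\<^sub>R v" x]
      by (simp add: power_mult_distrib power2_eq_square algebra_simps)
    then show ?thesis
      using that False by (simp add: inner_diff_left)
  qed simp
  have "\<phi> 0 \<le> \<phi> 1"
  proof (rule DERIV_nonneg_imp_nondecreasing[of 0 1 \<phi>])
    show "\<exists>d. (\<phi> has_real_derivative d) (at s) \<and> 0 \<le> d" if "0 \<le> s" "s \<le> 1" for s
      using deriv nonneg[OF that(1)] by blast
  qed simp
  then show ?thesis
    by (simp add: \<phi>_def v_def)
qed

lemma GDERIV_min_imp_zero:
  assumes "\<And>u. GDERIV g u :> g' u" "\<And>y. g x \<le> g y"
  shows "g' x = 0"
proof -
  have "((\<lambda>s. g (x + s *\<^sub>R g' x)) has_real_derivative g' x \<bullet> g' x) (at 0)"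
    using GDERIV_along_line[of g g' x "g' x" 0] assms(1) by simp
  then have "g' x \<bullet> g' x = 0"
    by (rule DERIV_local_min[where d = 1]) (use assms(2) in auto)
  then show ?thesis
    by simp
qed

section \<open>Existence of minimisers and surjectivity of strongly monotone gradients\<close>

lemma strongly_monotone_critical_point:
  fixes g :: "'a::euclidean_space \<Rightarrow> real"
  assumes "strongly_monotone \<mu> g'" "\<mu> > 0" "\<And>u. GDERIV g u :> g' u"
  obtains x where "g' x = 0"
proof -
  \<comment> \<open>Beyond this radius the quadratic term of the lower bound at \<open>0\<close>
    outweighs the linear one, so \<open>g y\<close> is at least \<open>g 0\<close>. A minimiser over
    the compact ball is therefore global.\<close>
  define R where "R = 2 * norm (g' 0) / \<mu>"
  have cont: "continuous_on (cball 0 R) g"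
    using assms(3) unfolding gderiv_def
    by (meson continuous_at_imp_continuous_on has_derivative_continuous)
  have R: "0 \<le> R"
    using assms(2) by (simp add: R_def)
  then obtain x where x: "x \<in> cball 0 R" "\<And>y. y \<in> cball 0 R \<Longrightarrow> g x \<le> g y"
    using continuous_attains_inf[OF compact_cball _ cont] by auto
  have "g x \<le> g y" for y
  proof (cases "y \<in> cball 0 R")
    case False
    then have "norm (g' 0) * norm y \<le> \<mu> / 2 * (norm y)\<^sup>2"
      using assms(2) mult_left_mono[of "2 * norm (g' 0)" "\<mu> * norm y" "norm y"]
      unfolding R_def by (simp add: power2_eq_square field_simps)
    moreover have "- (norm (g' 0) * norm y) \<le> g' 0 \<bullet> y"
      using Cauchy_Schwarz_ineq2[of "g' 0" y] by linarith
    ultimately have "g 0 \<le> g y"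
      using strongly_monotone_lower_bound[OF assms(1,3), of 0 y] by simp
    then show ?thesis
      using x(2)[of 0] R by simp
  qed (use x in auto)
  then show ?thesis
    using GDERIV_min_imp_zero[OF assms(3)] that by blast
qed

text \<open>As \<open>arg_min\<close> is a choice operator, its value is a minimiser only once one
  is known to exist; the critical point found above supplies it.\<close>

lemma strongly_monotone_arg_min:
  fixes g :: "'a::euclidean_space \<Rightarrow> real"
  assumes "strongly_monotone \<mu> g'" "\<mu> > 0" "\<And>u. GDERIV g u :> g' u"
  shows "g' (arg_min g (\<lambda>_. True)) = 0"
proof -
  obtain x where "g' x = 0"
    using strongly_monotone_critical_point[OF assms] by blast
  have "g x \<le> g y" for y
    using strongly_monotone_lower_bound[OF assms(1,3), of x y] \<open>g' x = 0\<close>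
      mult_nonneg_nonneg[OF less_imp_le[OF assms(2)], of "(norm (y - x))\<^sup>2"] by simp
  then have "is_arg_min g (\<lambda>_. True) x"
    by (simp add: is_arg_min_linorder)
  then have "is_arg_min g (\<lambda>_. True) (arg_min g (\<lambda>_. True))"
    unfolding arg_min_def by (rule someI)
  then show ?thesis
    by (intro GDERIV_min_imp_zero[OF assms(3)]) (auto simp: is_arg_min_linorder)
qed

text \<open>Tilting \<open>g\<close> by a linear functional preserves strong monotonicity, and the
  critical point of the tilted function solves the equation. This yields a primal point for every
  dual vector.\<close>

lemma strongly_monotone_surj:
  fixes g :: "'a::euclidean_space \<Rightarrow> real"
  assumes "strongly_monotone \<mu> g'" "\<mu> > 0" "\<And>u. GDERIV g u :> g' u"
  obtains x where "g' x = s"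
proof -
  have "strongly_monotone \<mu> (\<lambda>u. g' u - s)"
    using assms(1) by (simp add: strongly_monotone_def)
  moreover have "GDERIV (\<lambda>u. g u - u \<bullet> s) u :> g' u - s" for u
    by (intro GDERIV_diff assms(3)) (auto simp: gderiv_def intro!: derivative_eq_intros)
  ultimately show ?thesis
    using strongly_monotone_critical_point[of \<mu> "\<lambda>u. g' u - s" "\<lambda>u. g u - u \<bullet> s"] assms(2) that
    by auto
qed

text \<open>Passes the constant \<mu> on to the Hessian, the linear part of the predicted gradient.
  If it failed in direction \<open>v\<close>, then \<open>\<phi>\<close> would have negative slope
  at \<open>0\<close> and drop just to the right, against strong monotonicity.\<close>

lemma strongly_monotone_derivative:
  assumes "strongly_monotone \<mu> F" "(F has_derivative F') (at x)"
  shows "\<mu> * (norm v)\<^sup>2 \<le> F' v \<bullet> v"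
proof (rule ccontr)
  assume neg: "\<not> ?thesis"
  interpret F': bounded_linear F'
    using assms(2) by (rule has_derivative_bounded_linear)
  define \<phi> where "\<phi> s = F (x + s *\<^sub>R v) \<bullet> v - s * (\<mu> * (norm v)\<^sup>2)" for s
  have "((\<lambda>s. x + s *\<^sub>R v) has_derivative (\<lambda>h. h *\<^sub>R v)) (at 0)"
    by (auto intro!: derivative_eq_intros)
  then have "((\<lambda>s. F (x + s *\<^sub>R v)) has_derivative (\<lambda>h. F' (h *\<^sub>R v))) (at 0)"
    by (rule has_derivative_compose) (use assms(2) in simp)
  then have "(\<phi> has_derivative (\<lambda>h. F' (h *\<^sub>R v) \<bullet> v - h * (\<mu> * (norm v)\<^sup>2))) (at 0)"
    unfolding \<phi>_def by (auto intro!: derivative_eq_intros)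
  then have "(\<phi> has_real_derivative F' v \<bullet> v - \<mu> * (norm v)\<^sup>2) (at 0)"
    by (simp add: has_field_derivative_def F'.scaleR mult_commute_abs flip: right_diff_distrib)
  from DERIV_neg_dec_right[OF this] neg obtain d where
    d: "d > 0" "\<And>h. 0 < h \<Longrightarrow> h < d \<Longrightarrow> \<phi> h < \<phi> 0"
    by fastforce
  define h where "h = d / 2"
  have h: "h > 0" "h < d"
    using d(1) by (auto simp: h_def)
  have "h * (h * (\<mu> * (norm v)\<^sup>2)) \<le> h * ((F (x + h *\<^sub>R v) - F x) \<bullet> v)"
    using strongly_monotoneD[OF assms(1), of "x + h *\<^sub>R v" x]
    by (simp add: power_mult_distrib power2_eq_square algebra_simps)
  then have "\<phi> 0 \<le> \<phi> h"
    using h by (simp add: \<phi>_def inner_diff_left)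
  then show False
    using d(2) h by fastforce
qed

section \<open>Edge vectors\<close>

text \<open>These are the node blocks of the transpose of \<open>A\<close> applied to
  \<open>w\<close>; see \<open>adjoint_A_map\<close>.\<close>

definition node_sum :: "'v::finite pair_pre_digraph \<Rightarrow> real^'n^('v \<times> 'v) \<Rightarrow> 'v \<Rightarrow> real^'n" where
  "node_sum G w i = (\<Sum>j\<in>nbhd G i. w $ (i, j))"

lemma linear_A_map: "linear (A_map G)"
  by (rule linearI) (auto simp: A_map_def vec_eq_iff)

lemmas A_map_diff = linear_diff[OF linear_A_map]

lemma linear_P_map: "linear P_map"
  by (rule linearI) (auto simp: P_map_def vec_eq_iff)

lemmas P_map_simps = linear_diff[OF linear_P_map] linear_add[OF linear_P_map]
  linear_scale[OF linear_P_map] linear_neg[OF linear_P_map]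

lemma P_map_P_map [simp]: "P_map (P_map w) = w"
  by (simp add: P_map_def vec_eq_iff)

lemma inner_P_map: "P_map v \<bullet> P_map w = v \<bullet> w"
proof -
  have "(\<Sum>e\<in>UNIV. v $ (snd e, fst e) \<bullet> w $ (snd e, fst e)) = (\<Sum>e\<in>UNIV. v $ e \<bullet> w $ e)"
    by (rule sum.reindex_bij_witness[where i = prod.swap and j = prod.swap]) auto
  then show ?thesis
    by (simp add: inner_vec_def P_map_def)
qed

lemma norm_P_map [simp]: "norm (P_map w) = norm w"
  by (simp add: norm_eq_sqrt_inner inner_P_map)

text \<open>The swap is an isometric involution, so its eigenspaces for -1 and 1 are orthogonal.
  Dual feasible vectors lie in the first and optimal dual gradients in the second.\<close>

lemma antisymmetric_inner_symmetric:
  assumes "P_map v = - v" "P_map g = g"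
  shows "v \<bullet> g = 0"
  using inner_P_map[of v g] assms by simp

lemma sum_UNIV_pairs:
  "(\<Sum>e\<in>(UNIV :: ('v::finite \<times> 'v) set). F (fst e) (snd e)) = (\<Sum>i\<in>UNIV. \<Sum>j\<in>UNIV. F i j)"
  by (simp add: sum.cartesian_product split_def flip: UNIV_Times_UNIV)

lemma inner_A_map: "w \<bullet> A_map G x = (\<Sum>i\<in>UNIV. node_sum G w i \<bullet> x $ i)"
proof -
  have "w \<bullet> A_map G x = (\<Sum>e\<in>UNIV. (if (fst e, snd e) \<in> parcs G then w $ (fst e, snd e) \<bullet> x $ fst e else 0))"
    unfolding inner_vec_def A_map_def by (intro sum.cong) (auto simp: inner_vec_def)
  also have "\<dots> = (\<Sum>i\<in>UNIV. \<Sum>j\<in>UNIV. if j \<in> nbhd G i then w $ (i, j) \<bullet> x $ i else 0)"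
    unfolding sum_UNIV_pairs[where F = "\<lambda>i j. if (i, j) \<in> parcs G then w $ (i, j) \<bullet> x $ i else 0"]
    by (simp add: nbhd_def)
  also have "\<dots> = (\<Sum>i\<in>UNIV. node_sum G w i \<bullet> x $ i)"
    by (simp add: node_sum_def inner_sum_left sum.If_cases)
  finally show ?thesis .
qed

lemma node_sum_A_map: "node_sum G (A_map G x) i = real (node_degree G i) *\<^sub>R x $ i"
  by (simp add: node_sum_def A_map_def nbhd_def node_degree_def scaleR_conv_of_real del: sum_constant add: sum_constant_scaleR)

lemma node_sum_diff: "node_sum G (v - w) i = node_sum G v i - node_sum G w i"
  by (simp add: node_sum_def sum_subtractf)

lemma node_sum_scaleR: "node_sum G (c *\<^sub>R w) i = c *\<^sub>R node_sum G w i"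
  by (simp add: node_sum_def scaleR_sum_right)

lemma adjoint_A_map: "adjoint (A_map G) w = (\<chi> i. node_sum G w i)"
proof -
  have "x \<bullet> adjoint (A_map G) w = x \<bullet> (\<chi> i. node_sum G w i)" for x
    using adjoint_works[OF linear_A_map, of x G w] inner_A_map[of w G x]
    by (simp add: inner_commute inner_vec_def[of _ "\<chi> i. node_sum G w i"] inner_vec_def[of "\<chi> i. node_sum G w i"])
  then show ?thesis
    using vector_eq_ldot by blast
qed

lemma node_degree_le_max_degree: "node_degree G i \<le> max_degree G"
  by (simp add: max_degree_def)

lemma power2_norm_vec: "(norm (x :: 'a::real_inner^'i))\<^sup>2 = (\<Sum>i\<in>UNIV. (norm (x $ i))\<^sup>2)"
  by (simp add: power2_norm_eq_inner inner_vec_def)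

text \<open>The transpose of \<open>A\<close> times \<open>A\<close> is diagonal with the node
  degrees as entries, by \<open>node_sum_A_map\<close>.\<close>

lemma power2_norm_A_map_le: "(norm (A_map G x))\<^sup>2 \<le> real (max_degree G) * (norm x)\<^sup>2"
proof -
  have "(norm (A_map G x))\<^sup>2 = (\<Sum>i\<in>UNIV. real (node_degree G i) * (norm (x $ i))\<^sup>2)"
    unfolding power2_norm_eq_inner[of "A_map G x"] inner_A_map node_sum_A_map
    by (simp add: power2_norm_eq_inner)
  also have "\<dots> \<le> (\<Sum>i\<in>UNIV. real (max_degree G) * (norm (x $ i))\<^sup>2)"
    by (intro sum_mono mult_right_mono) (auto simp: node_degree_le_max_degree)
  finally show ?thesis
    by (simp add: power2_norm_vec sum_distrib_left)
qed

lemma norm_A_map_le: "norm (A_map G x) \<le> sqrt (real (max_degree G)) * norm x"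
  by (rule power2_le_imp_le) (auto simp: power_mult_distrib power2_norm_A_map_le)

lemma subspace_edge_space: "subspace (edge_space G)"
  by (auto simp: subspace_def edge_space_def)

lemma A_map_in_edge_space: "A_map G x \<in> edge_space G"
  by (simp add: A_map_def edge_space_def)

lemma P_map_in_edge_space:
  assumes "pair_graph G" "w \<in> edge_space G"
  shows "P_map w \<in> edge_space G"
proof -
  interpret pair_graph G by fact
  show ?thesis
    using assms(2) arcs_symmetric by (auto simp: P_map_def edge_space_def)
qed

section \<open>Contraction estimates in an inner product space\<close>

text \<open>Here \<open>w\<close> stands for a difference of dual vectors and \<open>b\<close> for
  the corresponding difference of \<open>A x\<close>. After expanding the squares, cocoercivity
  replaces \<open>b \<bullet> b\<close> by \<open>\<beta> * q\<close>, where
  \<open>l \<le> 1\<close> fixes the sign. What remains is linear in \<open>q\<close> on the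
  interval from \<open>0\<close> to \<open>\<beta> * p\<close>, so it suffices to check the two
  ends, which are the scalar cases of curvature \<epsilon> and
  \<open>\<epsilon> + \<beta>\<close>.\<close>

lemma reflection_contraction:
  fixes w b :: "'a::real_inner"
  assumes "\<epsilon> > 0" "\<rho> > 0" "\<beta> \<ge> 0" and coco: "(norm b)\<^sup>2 \<le> \<beta> * (w \<bullet> b)" "0 \<le> w \<bullet> b"
    and le: "\<bar>(1 - \<rho> * (\<epsilon> + \<beta>)) / (1 + \<rho> * (\<epsilon> + \<beta>))\<bar> \<le> l"
      "\<bar>(1 - \<rho> * \<epsilon>) / (1 + \<rho> * \<epsilon>)\<bar> \<le> l" and "l \<le> 1"
  shows "norm (\<rho> *\<^sub>R (\<epsilon> *\<^sub>R w + b) - w) \<le> l * norm (w + \<rho> *\<^sub>R (\<epsilon> *\<^sub>R w + b))"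
proof -
  have l: "0 \<le> l"
    using abs_ge_zero le(2) by (rule order_trans)
  then have l2: "l\<^sup>2 \<le> 1"
    using \<open>l \<le> 1\<close> by (simp add: power_le_one)
  define p q where "p = w \<bullet> w" and "q = w \<bullet> b"
  have sq: "(1 - \<rho> * c)\<^sup>2 \<le> l\<^sup>2 * (1 + \<rho> * c)\<^sup>2" if "c \<ge> 0" "\<bar>(1 - \<rho> * c) / (1 + \<rho> * c)\<bar> \<le> l" for c
  proof -
    have "\<bar>1 - \<rho> * c\<bar> \<le> l * (1 + \<rho> * c)"
      using that assms(2) by (simp add: abs_divide field_simps add_pos_nonneg)
    then show ?thesis
      using power_mono[of "\<bar>1 - \<rho> * c\<bar>" "l * (1 + \<rho> * c)" 2] by (simp add: power_mult_distrib)
  qed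
  \<comment> \<open>The remaining expression is \<open>a * p + c * q\<close>: it equals
    \<open>a * p\<close> at the left end and \<open>(a + \<beta> * c) * p\<close> at the right
    end.\<close>
  define a where "a = l\<^sup>2 * (1 + \<rho> * \<epsilon>)\<^sup>2 - (1 - \<rho> * \<epsilon>)\<^sup>2"
  define c where "c = 2 * \<rho> * (l\<^sup>2 * (1 + \<rho> * \<epsilon>) + (1 - \<rho> * \<epsilon>)) - \<rho>\<^sup>2 * (1 - l\<^sup>2) * \<beta>"
  have a: "0 \<le> a"
    using sq[of \<epsilon>] le assms(1) by (simp add: a_def)
  have "a + \<beta> * c = l\<^sup>2 * (1 + \<rho> * (\<epsilon> + \<beta>))\<^sup>2 - (1 - \<rho> * (\<epsilon> + \<beta>))\<^sup>2"
    unfolding a_def c_def by (simp add: power2_eq_square algebra_simps)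
  then have ac: "0 \<le> a + \<beta> * c"
    using sq[of "\<epsilon> + \<beta>"] le assms(1,3) by simp
  have q: "0 \<le> q" "q \<le> \<beta> * p"
  proof -
    show "0 \<le> q"
      using coco(2) by (simp add: q_def)
    have "q\<^sup>2 \<le> p * (b \<bullet> b)"
      unfolding p_def q_def by (rule Cauchy_Schwarz_ineq)
    also have "\<dots> \<le> p * (\<beta> * q)"
      using coco(1) by (intro mult_left_mono) (auto simp: p_def q_def power2_norm_eq_inner)
    finally have "q * q \<le> q * (\<beta> * p)"
      by (simp add: power2_eq_square mult_ac)
    then show "q \<le> \<beta> * p"
      using \<open>0 \<le> q\<close> assms(3) by (cases "q = 0") (auto simp: p_def)
  qed
  have nn: "0 \<le> \<rho>\<^sup>2 * (1 - l\<^sup>2)"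
    using l2 by simp
  have "0 \<le> a * p + c * q"
  proof (cases "c \<ge> 0")
    case True
    then show ?thesis
      using a q by (simp add: p_def)
  next
    case False
    have "0 \<le> (a + \<beta> * c) * p"
      using ac by (simp add: p_def)
    also have "\<dots> \<le> a * p + c * q"
      using False q(2) mult_left_mono_neg[of q "\<beta> * p" c] by (simp add: algebra_simps)
    finally show ?thesis .
  qed
  also have "\<dots> \<le> a * p + 2 * \<rho> * (l\<^sup>2 * (1 + \<rho> * \<epsilon>) + (1 - \<rho> * \<epsilon>)) * q - \<rho>\<^sup>2 * (1 - l\<^sup>2) * (b \<bullet> b)"
    using mult_left_mono[OF coco(1) nn]
    by (simp add: c_def q_def power2_norm_eq_inner algebra_simps)
  also have "\<dots> = l\<^sup>2 * (norm (w + \<rho> *\<^sub>R (\<epsilon> *\<^sub>R w + b)))\<^sup>2 - (norm (\<rho> *\<^sub>R (\<epsilon> *\<^sub>R w + b) - w))\<^sup>2"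
    unfolding a_def p_def q_def power2_norm_eq_inner
    by (simp add: inner_simps inner_commute power2_eq_square algebra_simps)
  finally have "(norm (\<rho> *\<^sub>R (\<epsilon> *\<^sub>R w + b) - w))\<^sup>2
      \<le> (l * norm (w + \<rho> *\<^sub>R (\<epsilon> *\<^sub>R w + b)))\<^sup>2"
    unfolding power_mult_distrib by (simp only: diff_ge_0_iff_ge)
  then show ?thesis
    by (rule power2_le_imp_le) (rule mult_nonneg_nonneg[OF l norm_ge_zero])
qed

text \<open>Pair the right-hand vector with \<open>w\<close>: \<open>b\<close> contributes a
  nonnegative term, and Cauchy-Schwarz bounds the pairing above.\<close>

lemma resolvent_nonexpansive:
  fixes w b :: "'a::real_inner"
  assumes "\<rho> * \<epsilon> \<ge> 0" "\<rho> \<ge> 0" "0 \<le> w \<bullet> b"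
  shows "(1 + \<rho> * \<epsilon>) * norm w \<le> norm (w + \<rho> *\<^sub>R (\<epsilon> *\<^sub>R w + b))"
proof (cases "w = 0")
  case False
  have "(1 + \<rho> * \<epsilon>) * norm w * norm w \<le> w \<bullet> (w + \<rho> *\<^sub>R (\<epsilon> *\<^sub>R w + b))"
    using assms mult_nonneg_nonneg[OF assms(2,3)]
    by (simp add: inner_simps algebra_simps flip: power2_norm_eq_inner power2_eq_square)
  also have "\<dots> \<le> norm w * norm (w + \<rho> *\<^sub>R (\<epsilon> *\<^sub>R w + b))"
    by (rule norm_cauchy_schwarz)
  finally show ?thesis
    using False by (simp add: mult.commute)
qed simp

section \<open>The ADMM step as a contraction\<close>

definition strong_costs ::
  "real \<Rightarrow> ('v \<Rightarrow> ('a::real_inner) \<Rightarrow> real) \<Rightarrow> ('v \<Rightarrow> 'a \<Rightarrow> 'a) \<Rightarrow> bool" where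
  "strong_costs \<mu> g g' \<longleftrightarrow> \<mu> > 0 \<and> (\<forall>i. strongly_monotone \<mu> (g' i) \<and> (\<forall>u. GDERIV (g i) u :> g' i u))"

text \<open>\<open>dual_point G g' w x\<close> says that \<open>x\<close> is the gradient of the conjugate cost at \<open>A\<^sup>T w\<close>.\<close>

definition dual_point ::
  "'v::finite pair_pre_digraph \<Rightarrow> ('v \<Rightarrow> real^'n \<Rightarrow> real^'n)
    \<Rightarrow> real^'n^('v \<times> 'v) \<Rightarrow> real^'n^'v \<Rightarrow> bool" where
  "dual_point G g' w x \<longleftrightarrow> w \<in> edge_space G \<and> (\<forall>i. g' i (x $ i) = node_sum G w i)"

text \<open>At a dual point this is the gradient of the smooth part of the regularized dual, with
  \<open>x\<close> standing for the gradient of the conjugate cost.\<close>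

definition dual_gradient ::
  "'v::finite pair_pre_digraph \<Rightarrow> real \<Rightarrow> real^'n^('v \<times> 'v) \<Rightarrow> real^'n^'v \<Rightarrow> real^'n^('v \<times> 'v)" where
  "dual_gradient G \<epsilon> w x = \<epsilon> *\<^sub>R w + A_map G x"

text \<open>The vector whose proximal point for the smooth part, with parameter \<rho>, is
  \<open>w\<close>. The iterate \<open>z\<close> of the algorithm has this form.\<close>

definition prox_argument ::
  "'v::finite pair_pre_digraph \<Rightarrow> real \<Rightarrow> real \<Rightarrow> real^'n^('v \<times> 'v) \<Rightarrow> real^'n^'v \<Rightarrow> real^'n^('v \<times> 'v)" where
  "prox_argument G \<epsilon> \<rho> w x = w + \<rho> *\<^sub>R dual_gradient G \<epsilon> w x"

text \<open>These are the optimality conditions of the regularized dual: the conjugate of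
  \<open>h\<close> confines \<open>w\<close> to antisymmetric vectors, and the gradient must be
  orthogonal to them, that is, symmetric.\<close>

definition saddle ::
  "'v::finite pair_pre_digraph \<Rightarrow> real \<Rightarrow> ('v \<Rightarrow> real^'n \<Rightarrow> real^'n)
    \<Rightarrow> real^'n^('v \<times> 'v) \<Rightarrow> real^'n^'v \<Rightarrow> bool" where
  "saddle G \<epsilon> g' w x \<longleftrightarrow> dual_point G g' w x \<and> P_map w = - w
     \<and> P_map (dual_gradient G \<epsilon> w x) = dual_gradient G \<epsilon> w x"

lemma dual_gradient_diff:
  "dual_gradient G \<epsilon> w x - dual_gradient G \<epsilon> v y = \<epsilon> *\<^sub>R (w - v) + A_map G (x - y)"
  by (simp add: dual_gradient_def A_map_diff algebra_simps)

lemma prox_argument_diff: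
  "prox_argument G \<epsilon> \<rho> w x - prox_argument G \<epsilon> \<rho> v y
    = (w - v) + \<rho> *\<^sub>R (\<epsilon> *\<^sub>R (w - v) + A_map G (x - y))"
  unfolding prox_argument_def dual_gradient_diff[symmetric] by (simp add: algebra_simps)

lemma prox_argument_in_edge_space:
  "w \<in> edge_space G \<Longrightarrow> prox_argument G \<epsilon> \<rho> w x \<in> edge_space G"
  unfolding prox_argument_def dual_gradient_def
  by (intro subspace_add subspace_scale subspace_edge_space A_map_in_edge_space)

lemma strong_costs_critical:
  fixes g :: "'v \<Rightarrow> 'a::euclidean_space \<Rightarrow> real"
  assumes "strong_costs \<mu> g g'"
  obtains u where "g' i u = s"
  using assms strongly_monotone_surj[of \<mu> "g' i" "g i" s] by (auto simp: strong_costs_def)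

lemma dual_point_exists:
  assumes "strong_costs \<mu> g g'" "w \<in> edge_space G"
  obtains x where "dual_point G g' w x"
proof -
  have "\<forall>i. \<exists>u. g' i u = node_sum G w i"
    using strong_costs_critical[OF assms(1)] by metis
  then obtain u where "\<forall>i. g' i (u i) = node_sum G w i"
    by metis
  then have "dual_point G g' w (\<chi> i. u i)"
    using assms(2) by (simp add: dual_point_def)
  then show ?thesis
    by (rule that)
qed

section \<open>Monotonicity, cocoercivity and Lipschitz bounds in the dual variable\<close>

lemma dual_point_monotone:
  assumes "strong_costs \<mu> g g'" "dual_point G g' w x" "dual_point G g' v y"
  shows "\<mu> * (norm (x - y))\<^sup>2 \<le> (w - v) \<bullet> A_map G (x - y)"
proof -
  have "\<mu> * (norm (x $ i - y $ i))\<^sup>2 \<le> node_sum G (w - v) i \<bullet> (x - y) $ i" for i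
    using assms strongly_monotoneD[of \<mu> "g' i" "x $ i" "y $ i"]
    by (simp add: strong_costs_def dual_point_def node_sum_diff)
  then show ?thesis
    unfolding inner_A_map power2_norm_vec sum_distrib_left by (intro sum_mono) simp
qed

lemma dual_point_inner_nonneg:
  assumes "strong_costs \<mu> g g'" "dual_point G g' w x" "dual_point G g' v y"
  shows "0 \<le> (w - v) \<bullet> A_map G (x - y)"
proof -
  have "0 \<le> \<mu> * (norm (x - y))\<^sup>2"
    using assms(1) by (simp add: strong_costs_def)
  also note dual_point_monotone[OF assms]
  finally show ?thesis .
qed

lemma dual_point_cocoercive:
  assumes "strong_costs \<mu> g g'" "dual_point G g' w x" "dual_point G g' v y"
  shows "(norm (A_map G (x - y)))\<^sup>2 \<le> real (max_degree G) / \<mu> * ((w - v) \<bullet> A_map G (x - y))"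
proof -
  have \<mu>: "\<mu> > 0"
    using assms(1) by (simp add: strong_costs_def)
  have "(norm (A_map G (x - y)))\<^sup>2 \<le> real (max_degree G) / \<mu> * (\<mu> * (norm (x - y))\<^sup>2)"
    using power2_norm_A_map_le[of G "x - y"] \<mu> by simp
  also have "\<dots> \<le> real (max_degree G) / \<mu> * ((w - v) \<bullet> A_map G (x - y))"
    using \<mu> by (intro mult_left_mono dual_point_monotone[OF assms]) simp
  finally show ?thesis .
qed

lemma dual_point_lipschitz:
  assumes "strong_costs \<mu> g g'" "dual_point G g' w x" "dual_point G g' v y"
  shows "norm (A_map G (x - y)) \<le> real (max_degree G) / \<mu> * norm (w - v)"
proof (cases "A_map G (x - y) = 0")
  case True
  then show ?thesis
    using assms(1) by (simp add: strong_costs_def)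
next
  case False
  have "norm (A_map G (x - y)) * norm (A_map G (x - y))
      \<le> real (max_degree G) / \<mu> * ((w - v) \<bullet> A_map G (x - y))"
    using dual_point_cocoercive[OF assms] by (simp add: power2_eq_square)
  also have "\<dots> \<le> real (max_degree G) / \<mu> * (norm (w - v) * norm (A_map G (x - y)))"
    using assms(1) by (intro mult_left_mono norm_cauchy_schwarz) (simp add: strong_costs_def)
  finally have "norm (A_map G (x - y)) * norm (A_map G (x - y))
      \<le> real (max_degree G) / \<mu> * norm (w - v) * norm (A_map G (x - y))"
    by (simp only: mult.assoc)
  then show ?thesis
    by (rule mult_right_le_imp_le) (use False in simp)
qed

lemma dual_gradient_lipschitz:
  assumes "strong_costs \<mu> g g'" "dual_point G g' w x" "dual_point G g' v y" "\<epsilon> > 0"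
  shows "norm (\<epsilon> *\<^sub>R (w - v) + A_map G (x - y)) \<le> L_bar (max_degree G) \<mu> \<epsilon> * norm (w - v)"
proof -
  have "norm (\<epsilon> *\<^sub>R (w - v) + A_map G (x - y)) \<le> \<epsilon> * norm (w - v) + norm (A_map G (x - y))"
    using norm_triangle_ineq[of "\<epsilon> *\<^sub>R (w - v)" "A_map G (x - y)"] assms(4) by simp
  then show ?thesis
    using dual_point_lipschitz[OF assms(1-3)] by (simp add: L_bar_def distrib_right)
qed

text \<open>This bound and \<open>prox_argument_upper\<close> translate between distances of dual
  variables and of proximal arguments. The quotient of their two factors is
  \<open>omega\<close>.\<close>

lemma prox_argument_lower:
  assumes "strong_costs \<mu> g g'" "dual_point G g' w x" "dual_point G g' v y" "\<epsilon> > 0" "\<rho> > 0"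
  shows "(1 + \<rho> * \<epsilon>) * norm (w - v)
    \<le> norm (prox_argument G \<epsilon> \<rho> w x - prox_argument G \<epsilon> \<rho> v y)"
  unfolding prox_argument_diff using assms
  by (intro resolvent_nonexpansive dual_point_inner_nonneg[OF assms(1-3)]) auto

lemma prox_argument_upper:
  assumes "strong_costs \<mu> g g'" "dual_point G g' w x" "dual_point G g' v y" "\<epsilon> > 0" "\<rho> > 0"
  shows "norm (prox_argument G \<epsilon> \<rho> w x - prox_argument G \<epsilon> \<rho> v y)
    \<le> (1 + \<rho> * L_bar (max_degree G) \<mu> \<epsilon>) * norm (w - v)"
proof -
  have "norm (prox_argument G \<epsilon> \<rho> w x - prox_argument G \<epsilon> \<rho> v y)
      \<le> norm (w - v) + \<rho> * norm (\<epsilon> *\<^sub>R (w - v) + A_map G (x - y))"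
    unfolding prox_argument_diff
    using assms(5) norm_triangle_ineq[of "w - v" "\<rho> *\<^sub>R (\<epsilon> *\<^sub>R (w - v) + A_map G (x - y))"]
    by (simp only: norm_scaleR abs_of_pos)
  also have "\<dots> \<le> norm (w - v) + \<rho> * (L_bar (max_degree G) \<mu> \<epsilon> * norm (w - v))"
    using assms(5) by (intro add_left_mono mult_left_mono dual_gradient_lipschitz[OF assms(1-4)]) simp
  finally show ?thesis
    by (simp add: algebra_simps)
qed

lemma lambda_rate_bounds:
  assumes "\<mu> > 0" "\<rho> > 0" "\<epsilon> > 0"
  shows "0 \<le> lambda_rate d \<mu> \<rho> \<epsilon>" "lambda_rate d \<mu> \<rho> \<epsilon> < 1"
proof -
  have "\<bar>(1 - \<rho> * c) / (1 + \<rho> * c)\<bar> < 1" if "c > 0" for c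
  proof -
    have "0 < \<rho> * c"
      using that assms by simp
    then show ?thesis
      by (simp add: abs_divide abs_less_iff)
  qed
  moreover have "L_bar d \<mu> \<epsilon> > 0"
    using assms by (simp add: L_bar_def add_pos_nonneg)
  ultimately show "lambda_rate d \<mu> \<rho> \<epsilon> < 1"
    using assms by (simp add: lambda_rate_def mu_bar_def)
  show "0 \<le> lambda_rate d \<mu> \<rho> \<epsilon>"
    by (simp add: lambda_rate_def le_max_iff_disj)
qed

text \<open>Up to sign, \<open>prox_argument - 2 w\<close> is the reflected resolvent
  \<open>2 w - z\<close>. Its differences have the form covered by
  \<open>reflection_contraction\<close>, with \<open>\<beta>\<close> the cocoercivity constant of
  the dual map.\<close>

lemma dual_reflection_contraction:
  assumes "strong_costs \<mu> g g'" "dual_point G g' w x" "dual_point G g' v y" "\<epsilon> > 0" "\<rho> > 0"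
  shows "norm ((prox_argument G \<epsilon> \<rho> w x - 2 *\<^sub>R w) - (prox_argument G \<epsilon> \<rho> v y - 2 *\<^sub>R v))
    \<le> lambda_rate (max_degree G) \<mu> \<rho> \<epsilon> * norm (prox_argument G \<epsilon> \<rho> w x - prox_argument G \<epsilon> \<rho> v y)"
proof -
  have \<mu>: "\<mu> > 0"
    using assms(1) by (simp add: strong_costs_def)
  have "(prox_argument G \<epsilon> \<rho> w x - 2 *\<^sub>R w) - (prox_argument G \<epsilon> \<rho> v y - 2 *\<^sub>R v)
      = \<rho> *\<^sub>R (\<epsilon> *\<^sub>R (w - v) + A_map G (x - y)) - (w - v)"
    using prox_argument_diff[of G \<epsilon> \<rho> w x v y] by (simp add: algebra_simps scaleR_2)
  moreover have "norm (\<rho> *\<^sub>R (\<epsilon> *\<^sub>R (w - v) + A_map G (x - y)) - (w - v))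
      \<le> lambda_rate (max_degree G) \<mu> \<rho> \<epsilon>
        * norm ((w - v) + \<rho> *\<^sub>R (\<epsilon> *\<^sub>R (w - v) + A_map G (x - y)))"
  proof (rule reflection_contraction[OF assms(4,5) _ dual_point_cocoercive[OF assms(1-3)]
        dual_point_inner_nonneg[OF assms(1-3)]])
    show "0 \<le> real (max_degree G) / \<mu>"
      using \<mu> by simp
    show "lambda_rate (max_degree G) \<mu> \<rho> \<epsilon> \<le> 1"
      using lambda_rate_bounds(2)[OF \<mu> assms(5,4)] by (rule less_imp_le)
  qed (simp_all only: lambda_rate_def L_bar_def mu_bar_def max.cobounded1 max.cobounded2)
  ultimately show ?thesis
    unfolding prox_argument_diff by simp
qed

section \<open>One ADMM step as a swapped reflection\<close>

lemma local_argmin_stationary: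
  assumes "strong_costs \<mu> g g'" "\<epsilon> > 0" "\<rho> > 0"
  shows "g' i (local_argmin G \<epsilon> \<rho> g z i)
    = delta \<epsilon> \<rho> *\<^sub>R (node_sum G z i - (\<rho> * real (node_degree G i)) *\<^sub>R local_argmin G \<epsilon> \<rho> g z i)"
proof -
  define c where "c = \<rho> * delta \<epsilon> \<rho> * real (node_degree G i)"
  define s where "s = delta \<epsilon> \<rho> *\<^sub>R node_sum G z i"
  have c: "0 \<le> c"
    using assms by (simp add: c_def delta_def)
  have cost: "\<mu> > 0" "strongly_monotone \<mu> (g' i)" "\<And>u. GDERIV (g i) u :> g' i u"
    using assms(1) by (auto simp: strong_costs_def)
  have "strongly_monotone \<mu> (\<lambda>u. g' i u + c *\<^sub>R u - s)"
    unfolding strongly_monotone_def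
  proof (intro allI)
    fix x y
    have "\<mu> * (norm (x - y))\<^sup>2 \<le> (g' i x - g' i y) \<bullet> (x - y) + c * ((x - y) \<bullet> (x - y))"
      using strongly_monotoneD[OF cost(2), of x y] c by (simp add: add_increasing2)
    then show "\<mu> * (norm (x - y))\<^sup>2 \<le> (g' i x + c *\<^sub>R x - s - (g' i y + c *\<^sub>R y - s)) \<bullet> (x - y)"
      by (simp add: inner_simps algebra_simps)
  qed
  moreover have "GDERIV (\<lambda>u. g i u + c / 2 * (norm u)\<^sup>2 - u \<bullet> s) u :> g' i u + c *\<^sub>R u - s" for u
  proof -
    have "GDERIV (\<lambda>u. u \<bullet> s) u :> s"
      by (auto simp: gderiv_def intro!: derivative_eq_intros)
    then show ?thesis
      by (intro GDERIV_diff GDERIV_add GDERIV_norm_power2 cost)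
  qed
  ultimately have "g' i m + c *\<^sub>R m - s = 0"
    if "m = arg_min (\<lambda>u. g i u + c / 2 * (norm u)\<^sup>2 - u \<bullet> s) (\<lambda>_. True)" for m
    unfolding that
    using strongly_monotone_arg_min[of \<mu> "\<lambda>u. g' i u + c *\<^sub>R u - s"
        "\<lambda>u. g i u + c / 2 * (norm u)\<^sup>2 - u \<bullet> s"] cost(1) by blast
  from this[of "local_argmin G \<epsilon> \<rho> g z i"] show ?thesis
    by (simp add: local_argmin_def c_def s_def node_sum_def algebra_simps)
qed

text \<open>Multiplying by \<open>1 + \<epsilon> * \<rho>\<close>, the inverse of
  \<open>delta\<close>, turns the formula by which the algorithm reads off \<open>w\<close> into the
  definition of the proximal argument.\<close>

lemma delta_prox_argument:
  assumes "\<epsilon> > 0" "\<rho> > 0"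
  shows "w = delta \<epsilon> \<rho> *\<^sub>R (z - \<rho> *\<^sub>R A_map G x) \<longleftrightarrow> z = prox_argument G \<epsilon> \<rho> w x"
proof -
  have "1 + \<epsilon> * \<rho> > 0"
    using assms by (simp add: add_pos_nonneg)
  then have "w = delta \<epsilon> \<rho> *\<^sub>R (z - \<rho> *\<^sub>R A_map G x) \<longleftrightarrow> (1 + \<epsilon> * \<rho>) *\<^sub>R w = z - \<rho> *\<^sub>R A_map G x"
    by (metis delta_def divideR_right inverse_eq_divide less_irrefl)
  also have "\<dots> \<longleftrightarrow> z = prox_argument G \<epsilon> \<rho> w x"
    by (auto simp: prox_argument_def dual_gradient_def algebra_simps)
  finally show ?thesis .
qed

text \<open>The right-hand side of the local stationarity condition is exactly the node sum of
  \<open>w\<close>, so the local minimisations jointly compute the resolvent of the dual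
  gradient.\<close>

lemma local_argmin_dual_point:
  assumes "strong_costs \<mu> g g'" "\<epsilon> > 0" "\<rho> > 0" "z \<in> edge_space G"
    and x: "x = (\<chi> i. local_argmin G \<epsilon> \<rho> g z i)" and w: "w = delta \<epsilon> \<rho> *\<^sub>R (z - \<rho> *\<^sub>R A_map G x)"
  shows "dual_point G g' w x"
  unfolding dual_point_def
proof
  show "w \<in> edge_space G"
    unfolding w by (intro subspace_scale subspace_diff subspace_edge_space A_map_in_edge_space assms(4))
  show "\<forall>i. g' i (x $ i) = node_sum G w i"
    unfolding w by (simp add: x local_argmin_stationary[OF assms(1-3)] node_sum_scaleR node_sum_diff node_sum_A_map)
qed

text \<open>Inserting \<open>w\<close> gives
  \<open>z - 2 w = (1 - 2 \<delta>) z + 2 \<delta> \<rho> A x\<close>, and the swap turns its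
  tail-node blocks into the head-node blocks of the update. The swap is minus the reflection through
  the antisymmetric vectors, which makes the step a Peaceman-Rachford step.\<close>

lemma admm_step_eq_reflection:
  assumes "pair_graph G" "z \<in> edge_space G"
    and "x = (\<chi> i. local_argmin G \<epsilon> \<rho> g z i)" "w = delta \<epsilon> \<rho> *\<^sub>R (z - \<rho> *\<^sub>R A_map G x)"
  shows "admm_step G \<epsilon> \<rho> g z = P_map (z - 2 *\<^sub>R w)"
proof -
  interpret pair_graph G by fact
  have swap: "(j, i) \<in> parcs G \<longleftrightarrow> (i, j) \<in> parcs G" for i j
    using arcs_symmetric by blast
  have "admm_step G \<epsilon> \<rho> g z $ (i, j) = P_map (z - 2 *\<^sub>R w) $ (i, j)" for i j
  proof (cases "(i, j) \<in> parcs G")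
    case True
    then show ?thesis
      using swap[of j i]
      by (simp add: assms(3,4) admm_step_def P_map_def A_map_def scaleR_diff_right scaleR_diff_left mult.assoc)
  next
    case False
    then have "z $ (j, i) = 0"
      using assms(2) swap by (simp add: edge_space_def)
    then show ?thesis
      using False swap[of j i] by (simp add: assms(3,4) admm_step_def P_map_def A_map_def)
  qed
  then show ?thesis
    by (simp add: vec_eq_iff)
qed

lemma admm_step_prox_argument:
  assumes "pair_graph G" "strong_costs \<mu> g g'" "\<epsilon> > 0" "\<rho> > 0" "dual_point G g' w x"
  shows "admm_step G \<epsilon> \<rho> g (prox_argument G \<epsilon> \<rho> w x) = P_map (prox_argument G \<epsilon> \<rho> w x - 2 *\<^sub>R w)"
proof -
  define z where "z = prox_argument G \<epsilon> \<rho> w x"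
  define y where "y = (\<chi> i. local_argmin G \<epsilon> \<rho> g z i)"
  define v where "v = delta \<epsilon> \<rho> *\<^sub>R (z - \<rho> *\<^sub>R A_map G y)"
  have z: "z \<in> edge_space G"
    using assms(5) by (simp add: z_def dual_point_def prox_argument_in_edge_space)
  have "dual_point G g' v y"
    using local_argmin_dual_point[OF assms(2-4) z y_def v_def] .
  moreover have "z = prox_argument G \<epsilon> \<rho> v y"
    using delta_prox_argument[OF assms(3,4)] v_def by blast
  \<comment> \<open>The pair recomputed from \<open>z\<close> by the algorithm has the same proximal
    argument as the given pair, and the lower bound makes the dual component unique.\<close>
  ultimately have "(1 + \<rho> * \<epsilon>) * norm (w - v) \<le> 0"
    using prox_argument_lower[OF assms(2,5) _ assms(3,4), of v y] by (simp add: z_def)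
  moreover have "1 + \<rho> * \<epsilon> > 0"
    using assms(3,4) by (simp add: add_pos_nonneg)
  ultimately have "v = w"
    by (simp add: mult_le_0_iff)
  then show ?thesis
    using admm_step_eq_reflection[OF assms(1) z y_def v_def] by (simp add: z_def)
qed

lemma edge_space_prox_argument:
  assumes "strong_costs \<mu> g g'" "\<epsilon> > 0" "\<rho> > 0" "z \<in> edge_space G"
  obtains w x where "dual_point G g' w x" "z = prox_argument G \<epsilon> \<rho> w x"
  using local_argmin_dual_point[OF assms refl refl] delta_prox_argument[OF assms(2,3)] that by blast

lemma admm_step_in_edge_space: "admm_step G \<epsilon> \<rho> g z \<in> edge_space G"
  by (simp add: admm_step_def edge_space_def)

lemma admm_step_contraction:
  assumes "pair_graph G" "strong_costs \<mu> g g'" "\<epsilon> > 0" "\<rho> > 0"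
    and "z \<in> edge_space G" "z' \<in> edge_space G"
  shows "norm (admm_step G \<epsilon> \<rho> g z - admm_step G \<epsilon> \<rho> g z')
    \<le> lambda_rate (max_degree G) \<mu> \<rho> \<epsilon> * norm (z - z')"
proof -
  obtain w x where wx: "dual_point G g' w x" "z = prox_argument G \<epsilon> \<rho> w x"
    using edge_space_prox_argument[OF assms(2-5)] .
  obtain v y where vy: "dual_point G g' v y" "z' = prox_argument G \<epsilon> \<rho> v y"
    using edge_space_prox_argument[OF assms(2-4,6)] .
  show ?thesis
    using dual_reflection_contraction[OF assms(2) wx(1) vy(1) assms(3,4)]
    unfolding wx(2) vy(2) admm_step_prox_argument[OF assms(1-4) wx(1)]
      admm_step_prox_argument[OF assms(1-4) vy(1)] linear_diff[OF linear_P_map, symmetric] norm_P_map .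
qed

section \<open>Fixed points, their existence and their dependence on the costs\<close>

lemma saddle_fixed_point:
  assumes "pair_graph G" "strong_costs \<mu> g g'" "\<epsilon> > 0" "\<rho> > 0" "dual_point G g' w x"
  shows "admm_step G \<epsilon> \<rho> g (prox_argument G \<epsilon> \<rho> w x) = prox_argument G \<epsilon> \<rho> w x
    \<longleftrightarrow> saddle G \<epsilon> g' w x"
proof -
  define d where "d = dual_gradient G \<epsilon> w x"
  have "P_map (prox_argument G \<epsilon> \<rho> w x - 2 *\<^sub>R w) = \<rho> *\<^sub>R P_map d - P_map w"
    by (simp add: prox_argument_def d_def P_map_simps scaleR_2)
  moreover have "\<rho> *\<^sub>R P_map d - P_map w = w + \<rho> *\<^sub>R d \<longleftrightarrow> P_map w = - w \<and> P_map d = d"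
  proof
    assume eq: "\<rho> *\<^sub>R P_map d - P_map w = w + \<rho> *\<^sub>R d"
    \<comment> \<open>Applying the involution gives a second equation; substituting the first into
      it eliminates the gradient and leaves antisymmetry of \<open>w\<close>.\<close>
    from arg_cong[OF this, of P_map] have "\<rho> *\<^sub>R d - w = P_map w + \<rho> *\<^sub>R P_map d"
      by (simp add: P_map_simps)
    with eq have "2 *\<^sub>R (P_map w + w) = 0"
      by (simp add: algebra_simps scaleR_2)
    then have "P_map w = - w"
      by (simp add: eq_neg_iff_add_eq_0)
    then show "P_map w = - w \<and> P_map d = d"
      using eq assms(4) by simp
  qed simp
  ultimately show ?thesis
    using assms(5) unfolding admm_step_prox_argument[OF assms] saddle_def
    by (simp add: prox_argument_def d_def)
qed

lemma saddle_exists: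
  assumes "pair_graph G" "strong_costs \<mu> g g'" "\<epsilon> > 0"
  obtains w x where "saddle G \<epsilon> g' w x"
proof -
  have \<mu>: "\<mu> > 0"
    using assms(2) by (simp add: strong_costs_def)
  have "\<exists>!z. z \<in> edge_space G \<and> admm_step G \<epsilon> 1 g z = z"
  proof (rule Banach_fix)
    show "complete (edge_space G)" "edge_space G \<noteq> {}"
      using complete_subspace[OF subspace_edge_space] subspace_0[OF subspace_edge_space] by auto
    show "0 \<le> lambda_rate (max_degree G) \<mu> 1 \<epsilon>" "lambda_rate (max_degree G) \<mu> 1 \<epsilon> < 1"
      using lambda_rate_bounds[OF \<mu> _ assms(3), of 1] by auto
    show "admm_step G \<epsilon> 1 g ` edge_space G \<subseteq> edge_space G"
      by (auto simp: admm_step_in_edge_space)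
    show "dist (admm_step G \<epsilon> 1 g z) (admm_step G \<epsilon> 1 g z')
        \<le> lambda_rate (max_degree G) \<mu> 1 \<epsilon> * dist z z'"
      if "z \<in> edge_space G" "z' \<in> edge_space G" for z z'
      using admm_step_contraction[OF assms _ that] by (simp add: dist_norm)
  qed
  then obtain z where z: "z \<in> edge_space G" "admm_step G \<epsilon> 1 g z = z"
    by blast
  obtain w x where "dual_point G g' w x" "z = prox_argument G \<epsilon> 1 w x"
    using edge_space_prox_argument[OF assms(2,3) _ z(1), of 1] by auto
  then show ?thesis
    using saddle_fixed_point[OF assms, of 1 w x] z(2) that by auto
qed

lemma admm_iterate_in_edge_space:
  "z \<in> edge_space G \<Longrightarrow> (admm_step G \<epsilon> \<rho> g ^^ n) z \<in> edge_space G"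
  by (induction n) (auto simp: admm_step_in_edge_space)

lemma admm_iterate_contraction:
  assumes "pair_graph G" "strong_costs \<mu> g g'" "\<epsilon> > 0" "\<rho> > 0"
    and "z \<in> edge_space G" "saddle G \<epsilon> g' w x"
  shows "norm ((admm_step G \<epsilon> \<rho> g ^^ n) z - prox_argument G \<epsilon> \<rho> w x)
    \<le> lambda_rate (max_degree G) \<mu> \<rho> \<epsilon> ^ n * norm (z - prox_argument G \<epsilon> \<rho> w x)"
proof (induction n)
  case (Suc n)
  have \<mu>: "\<mu> > 0"
    using assms(2) by (simp add: strong_costs_def)
  have wx: "dual_point G g' w x" "prox_argument G \<epsilon> \<rho> w x \<in> edge_space G"
    using assms(6) prox_argument_in_edge_space by (auto simp: saddle_def dual_point_def)
  have "admm_step G \<epsilon> \<rho> g (prox_argument G \<epsilon> \<rho> w x) = prox_argument G \<epsilon> \<rho> w x"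
    using saddle_fixed_point[OF assms(1-4) wx(1)] assms(6) by simp
  then have "norm ((admm_step G \<epsilon> \<rho> g ^^ Suc n) z - prox_argument G \<epsilon> \<rho> w x)
      \<le> lambda_rate (max_degree G) \<mu> \<rho> \<epsilon> * norm ((admm_step G \<epsilon> \<rho> g ^^ n) z - prox_argument G \<epsilon> \<rho> w x)"
    using admm_step_contraction[OF assms(1-4) admm_iterate_in_edge_space[OF assms(5)] wx(2)]
    by simp
  also have "\<dots> \<le> lambda_rate (max_degree G) \<mu> \<rho> \<epsilon>
      * (lambda_rate (max_degree G) \<mu> \<rho> \<epsilon> ^ n * norm (z - prox_argument G \<epsilon> \<rho> w x))"
    using lambda_rate_bounds[OF \<mu> assms(4,3)] by (intro mult_left_mono Suc.IH) auto
  finally show ?case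
    by (simp add: mult.assoc)
qed simp

text \<open>The vector \<open>r = A (y' - x)\<close> is the change of the dual gradient at the fixed
  vector \<open>w\<close> when the costs change. The difference of the saddles is antisymmetric and
  that of their gradients symmetric, so their pairing vanishes; monotonicity then leaves
  \<open>r\<close> against the \<epsilon>-strong part. For the second bound, first change costs at
  \<open>w\<close> and then move from \<open>w\<close> to \<open>v\<close>.\<close>

lemma saddle_perturbation:
  assumes "strong_costs \<mu> g g'" "\<epsilon> > 0" "\<rho> > 0"
    and v: "saddle G \<epsilon> g' v y" and w: "saddle G \<epsilon> h' w x" and y': "dual_point G g' w y'"
  shows "norm (v - w) \<le> norm (A_map G (y' - x)) / \<epsilon>"
    and "norm (prox_argument G \<epsilon> \<rho> v y - prox_argument G \<epsilon> \<rho> w x)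
      \<le> (1 + \<rho> * L_bar (max_degree G) \<mu> \<epsilon>) * norm (v - w) + \<rho> * norm (A_map G (y' - x))"
proof -
  have vy: "dual_point G g' v y"
    using v by (simp add: saddle_def)
  define r where "r = A_map G (y' - x)"
  have split: "A_map G (y - x) = A_map G (y - y') + r"
    by (simp add: r_def A_map_diff)
  have "(v - w) \<bullet> (dual_gradient G \<epsilon> v y - dual_gradient G \<epsilon> w x) = 0"
    using v w by (intro antisymmetric_inner_symmetric) (auto simp: saddle_def P_map_simps)
  then have "\<epsilon> * (norm (v - w))\<^sup>2 + (v - w) \<bullet> A_map G (y - y') = - ((v - w) \<bullet> r)"
    unfolding dual_gradient_diff split by (simp add: inner_add_right power2_norm_eq_inner)
  then have "\<epsilon> * (norm (v - w))\<^sup>2 \<le> - ((v - w) \<bullet> r)"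
    using dual_point_inner_nonneg[OF assms(1) vy y'] by simp
  also have "\<dots> \<le> norm (v - w) * norm r"
    using norm_cauchy_schwarz[of "v - w" "- r"] by simp
  finally have "(\<epsilon> * norm (v - w)) * norm (v - w) \<le> norm r * norm (v - w)"
    by (simp add: power2_eq_square mult_ac)
  then have "\<epsilon> * norm (v - w) \<le> norm r"
    by (cases "v = w") auto
  then show "norm (v - w) \<le> norm (A_map G (y' - x)) / \<epsilon>"
    using assms(2) by (simp add: r_def field_simps)
  have "prox_argument G \<epsilon> \<rho> v y - prox_argument G \<epsilon> \<rho> w x
      = (prox_argument G \<epsilon> \<rho> v y - prox_argument G \<epsilon> \<rho> w y') + \<rho> *\<^sub>R r"
    unfolding prox_argument_diff split by (simp add: algebra_simps)
  also have "norm \<dots> \<le> norm (prox_argument G \<epsilon> \<rho> v y - prox_argument G \<epsilon> \<rho> w y') + \<rho> * norm r"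
    using norm_triangle_ineq[of "prox_argument G \<epsilon> \<rho> v y - prox_argument G \<epsilon> \<rho> w y'" "\<rho> *\<^sub>R r"]
    by (simp only: norm_scaleR abs_of_pos[OF assms(3)])
  also have "\<dots> \<le> (1 + \<rho> * L_bar (max_degree G) \<mu> \<epsilon>) * norm (v - w) + \<rho> * norm r"
    using prox_argument_upper[OF assms(1) vy y' assms(2,3)] by simp
  finally show "norm (prox_argument G \<epsilon> \<rho> v y - prox_argument G \<epsilon> \<rho> w x)
      \<le> (1 + \<rho> * L_bar (max_degree G) \<mu> \<epsilon>) * norm (v - w) + \<rho> * norm (A_map G (y' - x))"
    by (simp add: r_def)
qed

section \<open>Dual optimality\<close>

lemma conjugate_cost_ge:
  "ereal (w \<bullet> A_map G x - total_cost f s x)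
    \<le> convex_conjugate (\<lambda>x. ereal (total_cost f s x)) (adjoint (A_map G) w)"
proof -
  have "adjoint (A_map G) w \<bullet> x = w \<bullet> A_map G x"
    using adjoint_works[OF linear_A_map, of x G w] by (simp add: inner_commute)
  then have "ereal (w \<bullet> A_map G x - total_cost f s x)
      = ereal (adjoint (A_map G) w \<bullet> x) - ereal (total_cost f s x)"
    by simp
  also have "\<dots> \<le> (SUP x. ereal (adjoint (A_map G) w \<bullet> x) - ereal (total_cost f s x))"
    by (rule SUP_upper) simp
  finally show ?thesis
    by (simp add: convex_conjugate_def)
qed

text \<open>The case of equality in Fenchel's inequality: at a dual point the node sums are the
  gradients of the costs, so the tangent bound shows that \<open>x\<close> attains the
  supremum.\<close>

lemma conjugate_cost_eq:
  assumes "strong_costs \<mu> (\<lambda>i u. f i u s) g'" "dual_point G g' w x"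
  shows "convex_conjugate (\<lambda>x. ereal (total_cost f s x)) (adjoint (A_map G) w)
    = ereal (w \<bullet> A_map G x - total_cost f s x)"
proof (rule antisym[OF _ conjugate_cost_ge])
  have "adjoint (A_map G) w \<bullet> y - total_cost f s y \<le> w \<bullet> A_map G x - total_cost f s x" for y
  proof -
    have "f i (x $ i) s + node_sum G w i \<bullet> (y $ i - x $ i) \<le> f i (y $ i) s" for i
    proof -
      have "0 \<le> \<mu> / 2 * (norm (y $ i - x $ i))\<^sup>2"
        using assms(1) by (simp add: strong_costs_def)
      moreover have "f i (x $ i) s + node_sum G w i \<bullet> (y $ i - x $ i) + \<mu> / 2 * (norm (y $ i - x $ i))\<^sup>2
          \<le> f i (y $ i) s"
        using assms strongly_monotone_lower_bound[of \<mu> "g' i" "\<lambda>u. f i u s" "x $ i" "y $ i"]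
        by (simp add: strong_costs_def dual_point_def)
      ultimately show ?thesis
        by linarith
    qed
    then have "(\<Sum>i\<in>UNIV. f i (x $ i) s + node_sum G w i \<bullet> (y $ i - x $ i)) \<le> total_cost f s y"
      unfolding total_cost_def by (intro sum_mono)
    then show ?thesis
      unfolding adjoint_A_map inner_A_map inner_vec_def[of "vec_lambda _"] total_cost_def
      by (simp add: sum.distrib inner_diff_right sum_subtractf)
  qed
  then show "convex_conjugate (\<lambda>x. ereal (total_cost f s x)) (adjoint (A_map G) w)
      \<le> ereal (w \<bullet> A_map G x - total_cost f s x)"
    unfolding convex_conjugate_def by (intro SUP_least) simp
qed

lemma conjugate_h_antisymmetric:
  fixes w :: "real^'n^('v::finite \<times> 'v)"
  assumes "P_map w = - w"
  shows "convex_conjugate (h_fun G) (- w) = 0"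
proof (rule antisym)
  have "(- w) \<bullet> y = 0" if "y \<in> ker_I_minus_P G" for y
    using antisymmetric_inner_symmetric[OF assms, of y] that by (simp add: ker_I_minus_P_def)
  then have "ereal ((- w) \<bullet> y) - h_fun G y \<le> 0" for y
    by (cases "y \<in> ker_I_minus_P G") (simp_all add: h_fun_def set_indicator_def)
  then show "convex_conjugate (h_fun G) (- w) \<le> 0"
    unfolding convex_conjugate_def by (intro SUP_least)
  have "(0 :: real^'n^('v \<times> 'v)) \<in> ker_I_minus_P G"
    using subspace_0[OF subspace_edge_space] by (simp add: ker_I_minus_P_def linear_0[OF linear_P_map])
  then have "0 = ereal ((- w) \<bullet> 0) - h_fun G (0 :: real^'n^('v \<times> 'v))"
    by (simp add: h_fun_def set_indicator_def zero_ereal_def)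
  also have "\<dots> \<le> convex_conjugate (h_fun G) (- w)"
    unfolding convex_conjugate_def by (rule SUP_upper) simp
  finally show "0 \<le> convex_conjugate (h_fun G) (- w)" .
qed

text \<open>The vector \<open>w + P w\<close> is then nonzero and symmetric and has positive pairing
  with \<open>w\<close>, so the supremum is unbounded along its negative multiples. Together with
  the preceding lemma, the conjugate acts as the indicator of antisymmetry on edge vectors.\<close>

lemma conjugate_h_not_antisymmetric:
  assumes "pair_graph G" "w \<in> edge_space G" "P_map w \<noteq> - w"
  shows "convex_conjugate (h_fun G) (- w) = \<infinity>"
  unfolding convex_conjugate_def
proof (rule SUP_PInfty)
  fix n :: nat
  define v where "v = w + P_map w"
  have v: "v \<noteq> 0" "P_map v = v" "v \<in> edge_space G"
  proof -
    show "v \<noteq> 0"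
      using assms(3) unfolding v_def eq_neg_iff_add_eq_0 add.commute[of w] .
    show "P_map v = v"
      unfolding v_def P_map_simps P_map_P_map by (rule add.commute)
    show "v \<in> edge_space G"
      unfolding v_def
      by (rule subspace_add[OF subspace_edge_space assms(2) P_map_in_edge_space[OF assms(1,2)]])
  qed
  have "v \<bullet> v = 2 * (w \<bullet> v)"
    using inner_P_map[of w v] v(2) unfolding v_def by (simp add: inner_add_left)
  then have pos: "w \<bullet> v > 0"
    using v(1) inner_gt_zero_iff[of v] by linarith
  define y where "y = - ((real n / (w \<bullet> v)) *\<^sub>R v)"
  have "y \<in> ker_I_minus_P G"
    using v subspace_scale[OF subspace_edge_space v(3), of "- (real n / (w \<bullet> v))"]
    by (simp add: y_def ker_I_minus_P_def P_map_simps)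
  moreover have "(- w) \<bullet> y = real n"
    using pos by (simp add: y_def)
  ultimately have "ereal (real n) \<le> ereal ((- w) \<bullet> y) - h_fun G y"
    by (simp add: h_fun_def set_indicator_def)
  then show "\<exists>y\<in>UNIV. ereal (real n) \<le> ereal ((- w) \<bullet> y) - h_fun G y"
    by blast
qed

lemma dual_obj_saddle:
  assumes "strong_costs \<mu> (\<lambda>i u. f i u s) g'" "saddle G \<epsilon> g' w x"
  shows "dual_obj G f s w = ereal (w \<bullet> A_map G x - total_cost f s x)"
  using assms conjugate_cost_eq[of \<mu> f s g' G w x] conjugate_h_antisymmetric[of w G]
  by (simp add: dual_obj_def saddle_def)

text \<open>Fenchel's inequality at \<open>x\<close> gives an affine minorant of the conjugate cost
  that is exact at \<open>w\<close>. With the regularizer added, the first-order term is the dual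
  gradient paired with \<open>v - w\<close>, which vanishes for antisymmetric \<open>v\<close>; only
  the quadratic remainder survives. Otherwise the right side is infinite.\<close>

lemma reg_dual_growth:
  assumes "pair_graph G" "strong_costs \<mu> (\<lambda>i u. f i u s) g'" "saddle G \<epsilon> g' w x" "v \<in> edge_space G"
  shows "ereal (\<epsilon> / 2 * (norm w)\<^sup>2) + dual_obj G f s w + ereal (\<epsilon> / 2 * (norm (v - w))\<^sup>2)
    \<le> ereal (\<epsilon> / 2 * (norm v)\<^sup>2) + dual_obj G f s v"
proof (cases "P_map v = - v")
  case True
  have "(v - w) \<bullet> dual_gradient G \<epsilon> w x = 0"
    using True assms(3) by (intro antisymmetric_inner_symmetric) (auto simp: saddle_def P_map_simps)
  then have "\<epsilon> / 2 * (norm w)\<^sup>2 + (w \<bullet> A_map G x - total_cost f s x) + \<epsilon> / 2 * (norm (v - w))\<^sup>2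
      = \<epsilon> / 2 * (norm v)\<^sup>2 + (v \<bullet> A_map G x - total_cost f s x)"
    unfolding power2_norm_eq_inner dual_gradient_def
    by (simp add: inner_simps inner_commute algebra_simps)
  then have "ereal (\<epsilon> / 2 * (norm w)\<^sup>2) + dual_obj G f s w + ereal (\<epsilon> / 2 * (norm (v - w))\<^sup>2)
      = ereal (\<epsilon> / 2 * (norm v)\<^sup>2) + ereal (v \<bullet> A_map G x - total_cost f s x)"
    unfolding dual_obj_saddle[of \<mu> f s g', OF assms(2,3)] by simp
  also have "\<dots> \<le> ereal (\<epsilon> / 2 * (norm v)\<^sup>2) + dual_obj G f s v"
    using conjugate_cost_ge[of v G x f s] conjugate_h_antisymmetric[OF True, of G]
    by (intro add_left_mono) (simp add: dual_obj_def)
  finally show ?thesis .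
next
  case False
  then have "dual_obj G f s v = \<infinity>"
    using conjugate_h_not_antisymmetric[OF assms(1,4)] by (simp add: dual_obj_def)
  then show ?thesis
    by simp
qed

lemma reg_dual_solution_saddle:
  assumes "pair_graph G" "strong_costs \<mu> (\<lambda>i u. f i u s) g'" "saddle G \<epsilon> g' w x" "\<epsilon> > 0"
  shows "reg_dual_solution G f \<epsilon> s = w"
proof -
  define F where "F v = ereal (\<epsilon> / 2 * (norm v)\<^sup>2) + dual_obj G f s v" for v
  have w: "w \<in> edge_space G"
    using assms(3) by (simp add: saddle_def dual_point_def)
  \<comment> \<open>Finiteness is what permits cancelling \<open>F w\<close> in the extended reals
    below, where growth forces the chosen minimiser to equal \<open>w\<close>.\<close>
  have Fw: "\<bar>F w\<bar> \<noteq> \<infinity>"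
    unfolding F_def dual_obj_saddle[of \<mu> f s g', OF assms(2,3)] by simp
  have growth: "F w + ereal (\<epsilon> / 2 * (norm (v - w))\<^sup>2) \<le> F v" if "v \<in> edge_space G" for v
    using reg_dual_growth[of G \<mu> f s g', OF assms(1-3) that] by (simp add: F_def)
  have le: "F w \<le> F v" if "v \<in> edge_space G" for v
    by (rule order_trans[OF _ growth[OF that]]) (use assms(4) in \<open>simp add: add_increasing2\<close>)
  then have "is_arg_min F (\<lambda>w. w \<in> edge_space G) w"
    using w by (auto simp: is_arg_min_def not_less)
  then have "is_arg_min F (\<lambda>w. w \<in> edge_space G) (arg_min F (\<lambda>w. w \<in> edge_space G))"
    unfolding arg_min_def by (rule someI)
  then have m: "arg_min F (\<lambda>w. w \<in> edge_space G) \<in> edge_space G"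
    "F (arg_min F (\<lambda>w. w \<in> edge_space G)) \<le> F w"
    using w by (auto simp: is_arg_min_def not_less)
  then have "F w + ereal (\<epsilon> / 2 * (norm (arg_min F (\<lambda>w. w \<in> edge_space G) - w))\<^sup>2) \<le> F w"
    using growth order_trans by blast
  then have "\<epsilon> / 2 * (norm (arg_min F (\<lambda>w. w \<in> edge_space G) - w))\<^sup>2 \<le> 0"
    using Fw by (cases "F w") auto
  then have "arg_min F (\<lambda>w. w \<in> edge_space G) = w"
    using assms(4) by (simp add: mult_le_0_iff)
  then show ?thesis
    by (simp add: reg_dual_solution_def F_def[abs_def])
qed

text \<open>Growth at \<open>v\<close>, combined with optimality of \<open>v\<close> for the
  unregularized objective, gives \<open>|w|^2 + |w - v|^2 \<le> |v|^2\<close>. The factor \<epsilon>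
  cancels, so the estimate is uniform in it.\<close>

lemma dual_solution_saddle_dist:
  assumes "pair_graph G" "strong_costs \<mu> (\<lambda>i u. f i u s) g'" "saddle G \<epsilon> g' w x" "\<epsilon> > 0"
    and "dual_solution G f s v"
  shows "norm (w - v) \<le> norm v"
proof -
  have w: "w \<in> edge_space G"
    using assms(3) by (simp add: saddle_def dual_point_def)
  have v: "v \<in> edge_space G" "dual_obj G f s v \<le> dual_obj G f s w"
    using assms(5) w by (auto simp: dual_solution_def is_arg_min_def not_less)
  define d where "d = w \<bullet> A_map G x - total_cost f s x"
  have "ereal (\<epsilon> / 2 * (norm w)\<^sup>2) + ereal d + ereal (\<epsilon> / 2 * (norm (v - w))\<^sup>2)
      \<le> ereal (\<epsilon> / 2 * (norm v)\<^sup>2) + ereal d"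
    using order_trans[OF reg_dual_growth[of G \<mu> f s g', OF assms(1-3) v(1)] add_left_mono[OF v(2)]]
    unfolding dual_obj_saddle[of \<mu> f s g', OF assms(2,3)] d_def .
  then have "\<epsilon> / 2 * ((norm w)\<^sup>2 + (norm (w - v))\<^sup>2) \<le> \<epsilon> / 2 * (norm v)\<^sup>2"
    by (simp add: norm_minus_commute distrib_left)
  then have "(norm w)\<^sup>2 + (norm (w - v))\<^sup>2 \<le> (norm v)\<^sup>2"
    using assms(4) by (simp only: mult_le_cancel_left_pos half_gt_zero)
  then have "(norm (w - v))\<^sup>2 \<le> (norm v)\<^sup>2"
    using zero_le_power2[of "norm w"] by linarith
  then show ?thesis
    by (rule power2_le_imp_le) simp
qed

section \<open>Drift under a change of costs, and the limit of an affine recursion\<close>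

text \<open>Both points answer the same dual vector, so the two gradients agree across
  \<open>x\<close> and \<open>y\<close>, and strong monotonicity bounds each node block by
  \<open>B / \<mu>\<close>. Summing squares over the nodes produces the square root of their
  number.\<close>

lemma norm_A_map_drift:
  fixes G :: "'v::finite pair_pre_digraph"
  assumes "strong_costs \<mu> g g'" "dual_point G g' w y" "dual_point G h' w x"
    and "\<And>i. norm (g' i (x $ i) - h' i (x $ i)) \<le> B"
  shows "norm (A_map G (y - x)) \<le> sqrt (real CARD('v)) * (sqrt (real (max_degree G)) * B / \<mu>)"
proof -
  have \<mu>: "\<mu> > 0"
    using assms(1) by (simp add: strong_costs_def)
  have B: "0 \<le> B"
    using assms(4) norm_ge_zero order_trans by blast
  have "norm ((y - x) $ i) \<le> B / \<mu>" for i
  proof -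
    have "\<mu> * (norm (y $ i - x $ i))\<^sup>2 \<le> (g' i (y $ i) - g' i (x $ i)) \<bullet> (y $ i - x $ i)"
      using assms(1) by (simp add: strong_costs_def strongly_monotoneD)
    also have "\<dots> = (h' i (x $ i) - g' i (x $ i)) \<bullet> (y $ i - x $ i)"
      using assms(2,3) by (simp add: dual_point_def)
    also have "\<dots> \<le> norm (h' i (x $ i) - g' i (x $ i)) * norm (y $ i - x $ i)"
      by (rule norm_cauchy_schwarz)
    also have "\<dots> \<le> B * norm (y $ i - x $ i)"
      using assms(4)[of i] by (intro mult_right_mono) (auto simp: norm_minus_commute)
    finally have "\<mu> * norm (y $ i - x $ i) * norm (y $ i - x $ i) \<le> B * norm (y $ i - x $ i)"
      by (simp only: power2_eq_square mult.assoc)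
    then have "\<mu> * norm (y $ i - x $ i) \<le> B"
      using B by (cases "y $ i = x $ i") auto
    then show ?thesis
      using \<mu> by (simp add: field_simps)
  qed
  then have "(norm ((y - x) $ i))\<^sup>2 \<le> (B / \<mu>)\<^sup>2" for i
    by (rule power_mono) simp
  then have "(\<Sum>i\<in>UNIV. (norm ((y - x) $ i))\<^sup>2) \<le> (\<Sum>i\<in>(UNIV :: 'v set). (B / \<mu>)\<^sup>2)"
    by (rule sum_mono)
  then have "(norm (y - x))\<^sup>2 \<le> (sqrt (real CARD('v)) * (B / \<mu>))\<^sup>2"
    unfolding power2_norm_vec[of "y - x"] power_mult_distrib by simp
  then have "norm (y - x) \<le> sqrt (real CARD('v)) * (B / \<mu>)"
    by (rule power2_le_imp_le) (use B \<mu> in simp)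
  then have "sqrt (real (max_degree G)) * norm (y - x)
      \<le> sqrt (real (max_degree G)) * (sqrt (real CARD('v)) * (B / \<mu>))"
    by (rule mult_left_mono) simp
  with norm_A_map_le[of G "y - x"] show ?thesis
    by (simp add: mult_ac)
qed

text \<open>The recursion is required only from index 1: the initial primal point is arbitrary and
  need not answer the initial dual vector.\<close>

lemma limsup_linear_recursion:
  fixes e X :: "nat \<Rightarrow> real"
  assumes rec: "\<And>k. k \<ge> 1 \<Longrightarrow> e (Suc k) \<le> \<eta> * e k + b" and \<eta>: "0 \<le> \<eta>" "\<eta> < 1"
    and X: "\<And>k. k \<ge> 1 \<Longrightarrow> X k \<le> e k + c"
  shows "limsup (\<lambda>k. ereal (X k)) \<le> ereal (b / (1 - \<eta>) + c)"
proof -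
  \<comment> \<open>The fixed point of the affine map, around which the error contracts
    geometrically.\<close>
  define B where "B = b / (1 - \<eta>)"
  have B: "\<eta> * B + b = B"
    using \<eta> by (simp add: B_def field_simps)
  have e: "e (Suc n) \<le> \<eta> ^ n * (e 1 - B) + B" for n
  proof (induction n)
    case (Suc n)
    have "e (Suc (Suc n)) \<le> \<eta> * e (Suc n) + b"
      by (rule rec) simp
    also have "\<dots> \<le> \<eta> * (\<eta> ^ n * (e 1 - B) + B) + b"
      using Suc.IH \<eta>(1) by (intro add_right_mono mult_left_mono)
    also have "\<dots> = \<eta> ^ Suc n * (e 1 - B) + (\<eta> * B + b)"
      by (simp add: algebra_simps)
    finally show ?case
      unfolding B .
  qed simp
  have "(\<lambda>n. \<eta> ^ n * (e 1 - B) + B + c) \<longlonglongrightarrow> 0 * (e 1 - B) + B + c"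
    using \<eta> by (intro tendsto_intros LIMSEQ_power_zero) simp
  then have "(\<lambda>n. ereal (\<eta> ^ n * (e 1 - B) + B + c)) \<longlonglongrightarrow> ereal (B + c)"
    by simp
  then have "limsup (\<lambda>n. ereal (\<eta> ^ n * (e 1 - B) + B + c)) = ereal (B + c)"
    by (intro lim_imp_Limsup) simp_all
  moreover have "limsup (\<lambda>n. ereal (X (Suc n))) \<le> limsup (\<lambda>n. ereal (\<eta> ^ n * (e 1 - B) + B + c))"
  proof (intro Limsup_mono always_eventually allI)
    show "ereal (X (Suc n)) \<le> ereal (\<eta> ^ n * (e 1 - B) + B + c)" for n
      using X[of "Suc n"] e[of n] by simp
  qed
  moreover have "limsup (\<lambda>n. ereal (X (Suc n))) = limsup (\<lambda>n. ereal (X n))"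
    using limsup_shift[of "\<lambda>n. ereal (X n)"] by simp
  ultimately show ?thesis
    by (simp add: B_def)
qed

section \<open>Tracking error\<close>

lemma L_bar_bounds:
  assumes "\<mu> > 0" "\<epsilon> > 0"
  shows "0 < L_bar d \<mu> \<epsilon>" "\<epsilon> \<le> L_bar d \<mu> \<epsilon>" "real d / \<mu> \<le> L_bar d \<mu> \<epsilon>"
  using assms by (auto simp: L_bar_def add_pos_nonneg)

lemma omega_lambda_rate_nonneg:
  assumes "\<mu> > 0" "\<rho> > 0" "\<epsilon> > 0"
  shows "0 \<le> omega d \<mu> \<rho> \<epsilon> * lambda_rate d \<mu> \<rho> \<epsilon> ^ n"
proof -
  have "0 \<le> \<rho> * L_bar d \<mu> \<epsilon>"
    using L_bar_bounds(1)[OF assms(1,3), of d] assms(2) by simp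
  then show ?thesis
    using lambda_rate_bounds(1)[OF assms, of d] assms by (simp add: omega_def mu_bar_def)
qed

lemma zeta_nonneg:
  assumes "\<mu> > 0" "\<rho> > 0" "\<epsilon> > 0"
  shows "0 \<le> zeta d \<mu> \<rho> \<epsilon> n"
  using omega_lambda_rate_nonneg[OF assms] by (simp add: zeta_def)

lemma xi_nonneg:
  assumes "\<mu> > 0" "\<rho> > 0" "\<epsilon> > 0"
  shows "0 \<le> xi d \<mu> \<rho> \<epsilon> n"
  using omega_lambda_rate_nonneg[OF assms] by (simp add: xi_def)

lemma kappa_bar_nonneg:
  assumes "\<mu> > 0" "\<epsilon> > 0"
  shows "0 \<le> kappa_bar d \<mu> \<epsilon>"
  using L_bar_bounds(1)[OF assms, of d] assms(2) by (simp add: kappa_bar_def mu_bar_def)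

text \<open>Without correction steps the leading \<open>zeta\<close> is 1, and the bracket is 1 for
  \<open>NP = 0\<close> and at least 2 otherwise. Positivity of \<open>NC\<close> is what gives
  \<open>zeta\<close> at \<open>NC\<close> its factor \<open>omega\<close>.\<close>

lemma eta1_less_one_imp_correction:
  assumes "\<mu> > 0" "\<rho> > 0" "\<epsilon> > 0" "eta1 d \<mu> \<rho> NP NC \<epsilon> < 1"
  shows "NC > 0"
proof (rule ccontr)
  assume "\<not> NC > 0"
  then have 1: "zeta d \<mu> \<rho> \<epsilon> NP + 2 * kappa_bar d \<mu> \<epsilon> * xi d \<mu> \<rho> \<epsilon> NP < 1"
    using assms(4) by (simp add: eta1_def zeta_def)
  then have NP: "NP > 0"
    by (cases "NP = 0") (simp_all add: zeta_def xi_def)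
  have "0 \<le> zeta d \<mu> \<rho> \<epsilon> NP" "1 \<le> xi d \<mu> \<rho> \<epsilon> NP"
    using NP omega_lambda_rate_nonneg[OF assms(1-3)] by (simp_all add: zeta_def xi_def)
  moreover have "1 \<le> kappa_bar d \<mu> \<epsilon>"
    using L_bar_bounds(2)[OF assms(1,3), of d] assms(3) by (simp add: kappa_bar_def mu_bar_def)
  then have "1 * 1 \<le> kappa_bar d \<mu> \<epsilon> * xi d \<mu> \<rho> \<epsilon> NP"
    using \<open>1 \<le> xi d \<mu> \<rho> \<epsilon> NP\<close> by (intro mult_mono) auto
  ultimately show False
    using 1 by linarith
qed

lemma eta1_nonneg:
  assumes "\<mu> > 0" "\<rho> > 0" "\<epsilon> > 0"
  shows "0 \<le> eta1 d \<mu> \<rho> NP NC \<epsilon>"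
  unfolding eta1_def
  by (intro mult_nonneg_nonneg add_nonneg_nonneg zeta_nonneg xi_nonneg kappa_bar_nonneg assms) simp

text \<open>Dividing by \<open>1 + \<rho> * \<epsilon>\<close> turns \<open>R\<close> into
  \<open>omega\<close>, which the correction factor \<open>zeta\<close> absorbs. The prediction
  factor is then weakened from \<open>l ^ NP\<close> to \<open>zeta\<close>, using
  \<open>omega \<ge> 1\<close>.\<close>

lemma admm_error_le_eta:
  fixes d :: nat and \<mu> \<rho> \<epsilon> :: real
  defines "R \<equiv> 1 + \<rho> * L_bar d \<mu> \<epsilon>" and "l \<equiv> lambda_rate d \<mu> \<rho> \<epsilon>" and "\<kappa> \<equiv> kappa_bar d \<mu> \<epsilon>"
  assumes pos: "\<mu> > 0" "\<rho> > 0" "\<epsilon> > 0" and "NC > 0" and e: "0 \<le> e"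
    and q: "q = C0_bar d \<mu> C\<^sub>0 * Ts / mu_bar \<epsilon>" "0 \<le> q"
    and e': "(1 + \<rho> * \<epsilon>) * e' \<le> l ^ NC *
      (if NP = 0 then R * (e + q) else l ^ NP * (R * (e + q)) + (1 + l ^ NP) * (R * (2 * \<kappa> * (e + q))))"
  shows "e' \<le> eta1 d \<mu> \<rho> NP NC \<epsilon> * e + eta0 d \<mu> C\<^sub>0 Ts \<rho> NP NC \<epsilon>"
proof -
  define m where "m = 1 + \<rho> * \<epsilon>"
  define Z where "Z = zeta d \<mu> \<rho> \<epsilon> NP"
  define X where "X = xi d \<mu> \<rho> \<epsilon> NP"
  have m: "m > 0"
    using pos by (simp add: m_def add_pos_nonneg)
  have mR: "m \<le> R"
    using L_bar_bounds(2)[OF pos(1,3), of d] pos(2) by (simp add: m_def R_def)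
  have l: "0 \<le> l"
    using lambda_rate_bounds[OF pos] by (simp add: l_def)
  have \<kappa>: "0 \<le> \<kappa>"
    using kappa_bar_nonneg[OF pos(1,3)] by (simp add: \<kappa>_def)
  have \<omega>: "omega d \<mu> \<rho> \<epsilon> = R / m"
    by (simp add: omega_def R_def m_def mu_bar_def)
  have eq: "0 \<le> e + q"
    using e q(2) by simp
  have "(if NP = 0 then R * (e + q) else l ^ NP * (R * (e + q)) + (1 + l ^ NP) * (R * (2 * \<kappa> * (e + q))))
      \<le> R * ((Z + 2 * \<kappa> * X) * (e + q))"
  proof (cases "NP = 0")
    case True
    then show ?thesis
      by (simp add: Z_def X_def zeta_def xi_def)
  next
    case False
    then have X: "X = 1 + Z"
      by (simp add: X_def Z_def xi_def zeta_def)
    have "l ^ NP = 1 * l ^ NP"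
      by simp
    also have "\<dots> \<le> R / m * l ^ NP"
      using m mR l by (intro mult_right_mono) (auto simp: field_simps)
    also have "\<dots> = Z"
      using False by (simp add: Z_def zeta_def \<omega> l_def)
    finally have "(l ^ NP + (1 + l ^ NP) * (2 * \<kappa>)) * (R * (e + q)) \<le> (Z + (1 + Z) * (2 * \<kappa>)) * (R * (e + q))"
      using \<kappa> m mR eq by (intro mult_right_mono add_mono) auto
    then show ?thesis
      using False by (simp add: X algebra_simps)
  qed
  then have "m * e' \<le> l ^ NC * (R * ((Z + 2 * \<kappa> * X) * (e + q)))"
    using e' l unfolding m_def by (meson mult_left_mono order_trans zero_le_power)
  then have "e' \<le> l ^ NC * (R * ((Z + 2 * \<kappa> * X) * (e + q))) / m"
    using m by (simp add: field_simps)
  also have "\<dots> = zeta d \<mu> \<rho> \<epsilon> NC * ((Z + 2 * \<kappa> * X) * (e + q))"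
    using \<open>NC > 0\<close> by (simp add: zeta_def \<omega> l_def)
  \<comment> \<open>The bracket of \<open>eta0\<close> contains
    \<open>2 * (1 + \<kappa> * X)\<close> instead of \<open>2 * \<kappa> * X\<close>, so
    \<open>2 * q\<close> is given away here.\<close>
  also have "\<dots> \<le> zeta d \<mu> \<rho> \<epsilon> NC * ((Z + 2 * \<kappa> * X) * e + q * (Z + 2 * (1 + \<kappa> * X)))"
    using q(2) by (intro mult_left_mono zeta_nonneg pos) (simp add: algebra_simps)
  also have "\<dots> = eta1 d \<mu> \<rho> NP NC \<epsilon> * e + eta0 d \<mu> C\<^sub>0 Ts \<rho> NP NC \<epsilon>"
    unfolding eta1_def eta0_def q(1) Z_def X_def \<kappa>_def by (simp only: algebra_simps)
  finally show ?thesis .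
qed

text \<open>
  The prediction starts from \<open>z\<close>, which is the proximal argument of the old dual point \<open>w\<close> for the
  old cost, not for the predicted one. Hence all fixed points are compared at the level of proximal
  arguments, where the ADMM step is a contraction, and only the first and last points are translated
  to dual variables.
\<close>

lemma prediction_correction_error:
  fixes G :: "'v::finite pair_pre_digraph" and \<mu> \<rho> \<epsilon> :: real and x :: "real^'n^'v"
  defines "Lb \<equiv> L_bar (max_degree G) \<mu> \<epsilon>" and "\<beta> \<equiv> real (max_degree G) / \<mu>"
    and "l \<equiv> lambda_rate (max_degree G) \<mu> \<rho> \<epsilon>" and "\<kappa> \<equiv> kappa_bar (max_degree G) \<mu> \<epsilon>"
  assumes graph: "pair_graph G" and pos: "\<epsilon> > 0" "\<rho> > 0"
    and cost: "strong_costs \<mu> g0 g0'" "strong_costs \<mu> g1 g1'" "strong_costs \<mu> gh gh'"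
    and wx: "dual_point G g0' w x"
    and saddles: "saddle G \<epsilon> g0' w0 x0" "saddle G \<epsilon> g1' w1 x1"
    and y: "dual_point G g1' w0 y" "norm (A_map G (y - x0)) \<le> a"
    and xh: "dual_point G gh' w xh" "norm (A_map G (xh - x)) \<le> a"
    and s: "norm (w1 - w0) \<le> s"
    and q: "s + a / Lb \<le> q" "2 * \<beta> * s + 2 * a \<le> q * \<beta>"
    and new: "dual_point G g1' w' x'"
      "prox_argument G \<epsilon> \<rho> w' x'
        = (admm_step G \<epsilon> \<rho> g1 ^^ NC) ((admm_step G \<epsilon> \<rho> gh ^^ NP) (prox_argument G \<epsilon> \<rho> w x))"
  shows "(1 + \<rho> * \<epsilon>) * norm (w' - w1) \<le> l ^ NC *
    (if NP = 0 then (1 + \<rho> * Lb) * (norm (w - w0) + q)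
     else l ^ NP * ((1 + \<rho> * Lb) * (norm (w - w0) + q))
       + (1 + l ^ NP) * ((1 + \<rho> * Lb) * (2 * \<kappa> * (norm (w - w0) + q))))"
proof -
  define R where "R = 1 + \<rho> * Lb"
  define e where "e = norm (w - w0)"
  define Z where "Z = prox_argument G \<epsilon> \<rho> w x"
  define Z0 where "Z0 = prox_argument G \<epsilon> \<rho> w0 x0"
  define Z1 where "Z1 = prox_argument G \<epsilon> \<rho> w1 x1"
  define zh where "zh = (admm_step G \<epsilon> \<rho> gh ^^ NP) Z"
  have \<mu>: "\<mu> > 0"
    using cost(1) by (simp add: strong_costs_def)
  have \<beta>: "0 \<le> \<beta>"
    using \<mu> by (simp add: \<beta>_def)
  have Lb: "0 < Lb" "\<epsilon> \<le> Lb" "\<beta> \<le> Lb" "Lb = \<epsilon> + \<beta>"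
    using L_bar_bounds[OF \<mu> pos(1)] by (simp_all add: Lb_def \<beta>_def L_bar_def)
  have l: "0 \<le> l"
    using lambda_rate_bounds[OF \<mu> pos(2,1)] by (simp add: l_def)
  have R: "0 < R"
    using Lb(1) pos(2) by (simp add: R_def add_pos_nonneg)
  have a: "0 \<le> a"
    using y(2) norm_ge_zero order_trans by blast
  have e: "0 \<le> e"
    by (simp add: e_def)
  have "0 \<le> s"
    using s norm_ge_zero order_trans by blast
  then have "0 \<le> s + a / Lb"
    using a Lb(1) by simp
  then have q0: "0 \<le> q"
    using q(1) by linarith
  \<comment> \<open>Relative to \<open>R\<close>, the factor \<rho> costs at most
    \<open>1 / Lb\<close>, whatever its size.\<close>
  have \<rho>R: "\<rho> * r \<le> R * (r / Lb)" if "0 \<le> r" for r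
    using that Lb(1) by (simp add: R_def field_simps)
  have dp: "dual_point G g0' w0 x0" "dual_point G g1' w1 x1"
    using saddles by (simp_all add: saddle_def)
  have Zmem: "Z \<in> edge_space G"
    using wx by (simp add: Z_def dual_point_def prox_argument_in_edge_space)

  have "norm (Z - Z0) \<le> R * e"
    using prox_argument_upper[OF cost(1) wx dp(1) pos] by (simp add: Z_def Z0_def R_def e_def Lb_def)
  moreover have "norm (Z1 - Z0) \<le> R * q"
  proof -
    have "norm (Z1 - Z0) \<le> R * norm (w1 - w0) + \<rho> * norm (A_map G (y - x0))"
      using saddle_perturbation(2)[OF cost(2) pos saddles(2,1) y(1)]
      by (simp add: Z1_def Z0_def R_def Lb_def)
    also have "\<dots> \<le> R * s + \<rho> * a"
      using R pos(2) s y(2) by (intro add_mono mult_left_mono) auto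
    also have "\<dots> \<le> R * s + R * (a / Lb)"
      using \<rho>R[OF a] by simp
    also have "\<dots> \<le> R * q"
      using mult_left_mono[OF q(1), of R] R by (simp add: distrib_left)
    finally show ?thesis .
  qed
  ultimately have ZZ1: "norm (Z - Z1) \<le> R * (e + q)"
    using norm_triangle_ineq4[of "Z - Z0" "Z1 - Z0"] by (simp add: distrib_left)

  have "norm (zh - Z1) \<le> (if NP = 0 then R * (e + q)
      else l ^ NP * (R * (e + q)) + (1 + l ^ NP) * (R * (2 * \<kappa> * (e + q))))"
  proof (cases "NP = 0")
    case True
    then show ?thesis
      using ZZ1 by (simp add: zh_def)
  next
    case False
    obtain v u where vu: "saddle G \<epsilon> gh' v u"
      using saddle_exists[OF graph cost(3) pos(1)] .
    define Zh where "Zh = prox_argument G \<epsilon> \<rho> v u"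
    obtain y' where y': "dual_point G gh' w1 y'"
      using dual_point_exists[OF cost(3)] dp(2) by (auto simp: dual_point_def)
    \<comment> \<open>This is the mismatch between predicted and new costs at the new solution
      \<open>w1\<close>. It is bounded along a detour: predicted costs from \<open>w1\<close> to
      \<open>w\<close>, predicted to old costs at \<open>w\<close>, old costs from \<open>w\<close>
      to \<open>w0\<close>, old to new costs at \<open>w0\<close>, new costs from \<open>w0\<close>
      to \<open>w1\<close>. Moves within one cost use the Lipschitz constant \<open>\<beta>\<close>,
      changes of cost use \<open>a\<close>.\<close>
    define r where "r = norm (A_map G (y' - x1))"
    have tri: "norm (p1 + p2 + p3 - p4 - p5) \<le> norm p1 + norm p2 + norm p3 + norm p4 + norm p5"
      for p1 p2 p3 p4 p5 :: "real^'n^('v \<times> 'v)"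
      using norm_triangle_ineq4[of "p1 + p2 + p3 - p4" p5] norm_triangle_ineq4[of "p1 + p2 + p3" p4]
        norm_triangle_ineq[of "p1 + p2" p3] norm_triangle_ineq[of p1 p2] by linarith
    have "A_map G (y' - x1) = A_map G (y' - xh) + A_map G (xh - x) + A_map G (x - x0)
        - A_map G (y - x0) - A_map G (x1 - y)"
      by (simp add: A_map_diff)
    then have "r \<le> norm (A_map G (y' - xh)) + norm (A_map G (xh - x)) + norm (A_map G (x - x0))
        + norm (A_map G (y - x0)) + norm (A_map G (x1 - y))"
      unfolding r_def
      using tri[of "A_map G (y' - xh)" "A_map G (xh - x)" "A_map G (x - x0)"] by simp
    also have "\<dots> \<le> \<beta> * (e + s) + a + \<beta> * e + a + \<beta> * s"
    proof (intro add_mono)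
      have "norm (w1 - w) \<le> e + s"
        using norm_triangle_ineq4[of "w1 - w0" "w - w0"] s by (simp add: e_def)
      with \<beta> show "norm (A_map G (y' - xh)) \<le> \<beta> * (e + s)"
        using order_trans[OF dual_point_lipschitz[OF cost(3) y' xh(1)] mult_left_mono] by (simp add: \<beta>_def)
      show "norm (A_map G (x - x0)) \<le> \<beta> * e"
        using dual_point_lipschitz[OF cost(1) wx dp(1)] by (simp add: \<beta>_def e_def)
      show "norm (A_map G (x1 - y)) \<le> \<beta> * s"
        using order_trans[OF dual_point_lipschitz[OF cost(2) dp(2) y(1)] mult_left_mono[OF s]] \<beta>
        by (simp add: \<beta>_def)
    qed (use xh y in auto)
    also have "\<dots> \<le> \<beta> * (2 * e + q)"
      using q(2) by (simp add: algebra_simps)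
    finally have r: "r \<le> \<beta> * (2 * e + q)" .
    have r0: "0 \<le> r"
      by (simp add: r_def)
    have "norm (Zh - Z1) \<le> R * norm (v - w1) + \<rho> * r"
      using saddle_perturbation(2)[OF cost(3) pos vu saddles(2) y']
      by (simp add: Zh_def Z1_def R_def r_def Lb_def)
    \<comment> \<open>The first term comes from the displacement of the saddle, the second from the
      change of its gradient; their coefficients combine into
      \<open>\<kappa> = 1 + \<beta> / \<epsilon>\<close> because
      \<open>\<beta> \<le> Lb\<close>.\<close>
    also have "\<dots> \<le> R * (r / \<epsilon>) + R * (r / Lb)"
      using saddle_perturbation(1)[OF cost(3) pos vu saddles(2) y'] R \<rho>R[OF r0]
      by (intro add_mono mult_left_mono) (auto simp: r_def)
    also have "\<dots> = R * (r * (1 / \<epsilon> + 1 / Lb))"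
      by (simp add: algebra_simps)
    also have "\<dots> \<le> R * (2 * \<kappa> * (e + q))"
    proof (rule mult_left_mono)
      have "r * (1 / \<epsilon> + 1 / Lb) \<le> \<beta> * (2 * e + q) * (1 / \<epsilon> + 1 / Lb)"
        using r Lb(1) pos(1) by (intro mult_right_mono) auto
      also have "\<dots> = (2 * e + q) * (\<beta> / \<epsilon> + \<beta> / Lb)"
        by (simp add: algebra_simps)
      also have "\<dots> \<le> (2 * e + q) * \<kappa>"
      proof (rule mult_left_mono)
        have "\<beta> / Lb \<le> 1"
          using Lb by (simp add: field_simps)
        moreover have "\<kappa> = 1 + \<beta> / \<epsilon>"
          using pos(1) Lb(4) by (simp add: \<kappa>_def kappa_bar_def mu_bar_def Lb_def add_divide_distrib)
        ultimately show "\<beta> / \<epsilon> + \<beta> / Lb \<le> \<kappa>"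
          by simp
      qed (use e q0 in simp)
      also have "\<dots> \<le> 2 * \<kappa> * (e + q)"
        using q0 kappa_bar_nonneg[OF \<mu> pos(1), of "max_degree G"] by (simp add: \<kappa>_def algebra_simps)
      finally show "r * (1 / \<epsilon> + 1 / Lb) \<le> 2 * \<kappa> * (e + q)" .
    qed (use R in simp)
    finally have ZhZ1: "norm (Zh - Z1) \<le> R * (2 * \<kappa> * (e + q))" .
    have "norm (zh - Zh) \<le> l ^ NP * norm (Z - Zh)"
      using admm_iterate_contraction[OF graph cost(3) pos Zmem vu] by (simp add: zh_def Zh_def l_def)
    also have "\<dots> \<le> l ^ NP * (R * (e + q) + R * (2 * \<kappa> * (e + q)))"
      using norm_triangle_ineq4[of "Z - Z1" "Zh - Z1"] ZZ1 ZhZ1 l by (intro mult_left_mono) auto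
    finally have "norm (zh - Zh) \<le> l ^ NP * (R * (e + q) + R * (2 * \<kappa> * (e + q)))" .
    then have "norm (zh - Z1) \<le> l ^ NP * (R * (e + q) + R * (2 * \<kappa> * (e + q))) + R * (2 * \<kappa> * (e + q))"
      using norm_triangle_ineq[of "zh - Zh" "Zh - Z1"] ZhZ1 by simp
    then show ?thesis
      using False by (simp add: algebra_simps)
  qed
  moreover have "(1 + \<rho> * \<epsilon>) * norm (w' - w1) \<le> l ^ NC * norm (zh - Z1)"
  proof -
    have "zh \<in> edge_space G"
      unfolding zh_def by (rule admm_iterate_in_edge_space[OF Zmem])
    from admm_iterate_contraction[OF graph cost(2) pos this saddles(2), of NC]
    have "norm (prox_argument G \<epsilon> \<rho> w' x' - Z1) \<le> l ^ NC * norm (zh - Z1)"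
      by (simp add: new(2) zh_def Z_def Z1_def l_def)
    then show ?thesis
      using prox_argument_lower[OF cost(2) new(1) dp(2) pos] by (simp add: Z1_def)
  qed
  ultimately show ?thesis
    unfolding e_def R_def using l by (meson mult_left_mono order_trans zero_le_power)
qed

section \<open>Application to the sampled and predicted costs\<close>

lemma predicted_costs_strong:
  assumes "predicted_costs grad hess tgrad Ts s x g" "\<mu> > 0"
    and "\<And>i v. \<mu> * (norm v)\<^sup>2 \<le> (hess i (x $ i) s *v v) \<bullet> v"
  shows "strong_costs \<mu> g
    (\<lambda>i u. grad i (x $ i) s + hess i (x $ i) s *v (u - x $ i) + Ts *\<^sub>R tgrad i (x $ i) s)"
  unfolding strong_costs_def
proof (intro conjI allI)
  fix i
  have "hess i (x $ i) s *v (u - x $ i) - hess i (x $ i) s *v (v - x $ i) = hess i (x $ i) s *v (u - v)" for u v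
    by (simp flip: matrix_vector_mult_diff_distrib)
  then show "strongly_monotone \<mu>
      (\<lambda>u. grad i (x $ i) s + hess i (x $ i) s *v (u - x $ i) + Ts *\<^sub>R tgrad i (x $ i) s)"
    unfolding strongly_monotone_def using assms(3)[of _ i] by simp
qed (use assms(1,2) in \<open>auto simp: predicted_costs_def\<close>)

lemma vector_derivative_bound_imp_lipschitz:
  fixes F :: "real \<Rightarrow> 'a::real_normed_vector"
  assumes "\<And>r. r \<ge> 0 \<Longrightarrow> (F has_vector_derivative F' r) (at r within {0..})"
    and "\<And>r. r \<ge> 0 \<Longrightarrow> norm (F' r) \<le> B" "a \<ge> 0" "b \<ge> 0"
  shows "norm (F b - F a) \<le> B * \<bar>b - a\<bar>"
proof -
  have "norm (F b - F a) \<le> B * norm (b - a)"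
  proof (rule differentiable_bound[where S = "{0..}"])
    fix r :: real
    assume r: "r \<in> {0..}"
    then show "(F has_derivative (\<lambda>h. h *\<^sub>R F' r)) (at r within {0..})"
      using assms(1) by (simp add: has_vector_derivative_def)
    show "onorm (\<lambda>h. h *\<^sub>R F' r) \<le> B"
      using r assms(2)[of r] order_trans[OF norm_ge_zero[of "F' r"]]
      by (intro onorm_bound) (auto simp: mult.commute[of B] intro: mult_left_mono)
  qed (use assms in auto)
  then show ?thesis
    by simp
qed

theorem proposition1:
  fixes G :: "'v::finite pair_pre_digraph"
    and f :: "'v \<Rightarrow> real^'n \<Rightarrow> real \<Rightarrow> real"
    and grad :: "'v \<Rightarrow> real^'n \<Rightarrow> real \<Rightarrow> real^'n"
    and hess :: "'v \<Rightarrow> real^'n \<Rightarrow> real \<Rightarrow> real^'n^'n"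
    and tgrad :: "'v \<Rightarrow> real^'n \<Rightarrow> real \<Rightarrow> real^'n"
    and t :: "nat \<Rightarrow> real"
    and Ts \<mu> L C\<^sub>0 C :: real
    and Eps :: "real set"
    and wstar :: "nat \<Rightarrow> real^'n^('v \<times> 'v)"
  assumes graph: "pair_graph G" "pverts G = UNIV" "Digraph_Component.connected (with_proj G)"
    and times: "t 0 \<ge> 0" "Ts > 0" "\<And>k. t (Suc k) - t k = Ts"
    and grad: "\<And>i x s. s \<ge> 0 \<Longrightarrow> GDERIV (\<lambda>u. f i u s) x :> grad i x s"
    and hess: "\<And>i x s. s \<ge> 0 \<Longrightarrow>
        ((\<lambda>u. grad i u s) has_derivative (\<lambda>v. hess i x s *v v)) (at x)"
    and tgrad: "\<And>i x s. s \<ge> 0 \<Longrightarrow>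
        ((\<lambda>r. grad i x r) has_vector_derivative tgrad i x s) (at s within {0..})"
    and constants: "\<mu> > 0" "L > 0" "C\<^sub>0 \<ge> 0"
    and costs: "\<And>i s. s \<ge> 0 \<Longrightarrow> (\<lambda>u. f i u s) \<in> S_class \<mu> L"
    and tgrad_bound: "\<And>i x s. s \<ge> 0 \<Longrightarrow> norm (tgrad i x s) \<le> C\<^sub>0"
    and primal_finite: "\<And>k. \<exists>xy. primal_solution G f (t k) xy \<and> \<bar>primal_obj G f (t k) xy\<bar> \<noteq> \<infinity>"
    and wstar: "\<And>k. dual_solution G f (t k) (wstar k)"
    and Eps_pos: "Eps \<subseteq> {0<..}"
    and C_bound: "\<And>k \<epsilon>. \<epsilon> \<in> Eps \<Longrightarrow>
        max (norm (wstar k)) (norm (reg_dual_solution G f \<epsilon> (t k))) \<le> C"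
  shows "\<exists>\<psi>\<^sub>0>0. \<forall>\<^sub>F \<epsilon> in at_right 0. \<epsilon> \<in> Eps \<longrightarrow>
    (\<forall>\<rho> N\<^sub>P N\<^sub>C x0 x z w.
       \<rho> > 0 \<longrightarrow>
       eta1 (max_degree G) \<mu> \<rho> N\<^sub>P N\<^sub>C \<epsilon> < 1 \<longrightarrow>
       pc_dr_admm G f grad hess tgrad t Ts \<epsilon> \<rho> N\<^sub>P N\<^sub>C x0 x z w \<longrightarrow>
       limsup (\<lambda>k. ereal (norm (w k - wstar k)))
         \<le> ereal (eta0 (max_degree G) \<mu> C\<^sub>0 Ts \<rho> N\<^sub>P N\<^sub>C \<epsilon>
                    / (1 - eta1 (max_degree G) \<mu> \<rho> N\<^sub>P N\<^sub>C \<epsilon>)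
                  + C * (1 + \<psi>\<^sub>0 * \<epsilon>)))"
proof -
  interpret pair_graph G by fact
  define dM where "dM = max_degree G"
  define \<beta> where "\<beta> = real dM / \<mu>"
  define c where "c = C0_bar dM \<mu> C\<^sub>0 * Ts"
  define a where "a = sqrt (real CARD('v)) * c"
  \<comment> \<open>Chosen to dominate \<open>2 * s + 2 * (a / \<beta>)\<close> when
    \<open>s \<le> 2 * C\<close>, so \<open>\<epsilon> * M \<le> c\<close> yields both smallness
    conditions on \<open>q = c / \<epsilon>\<close>. If \<open>\<beta>\<close> is zero, then so is
    \<open>c\<close>, and the default value of the quotient does no harm.\<close>
  define M where "M = 4 * C + 2 * a / \<beta>"
  have c0: "0 \<le> c"
    using constants times(2) by (simp add: c_def C0_bar_def)
  have a0: "0 \<le> a"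
    using c0 by (simp add: a_def)
  have \<beta>0: "0 \<le> \<beta>"
    using constants by (simp add: \<beta>_def)
  have t0: "0 \<le> t k" for k
    by (induction k) (use times in \<open>auto simp: algebra_simps add_increasing2 dest: spec\<close>)
  have cost: "strong_costs \<mu> (\<lambda>i u. f i u (t k)) (\<lambda>i u. grad i u (t k))" for k
    unfolding strong_costs_def
    using constants(1) grad[OF t0] costs[OF t0, of _ k]
    by (auto simp: S_class_def intro: strongly_convex_imp_strongly_monotone[OF _ grad[OF t0]])
  have drift: "norm (grad i u (t (Suc k)) - grad i u (t k)) \<le> C\<^sub>0 * Ts" for i u k
    using vector_derivative_bound_imp_lipschitz[of "grad i u" "tgrad i u" C\<^sub>0 "t k" "t (Suc k)"]
      tgrad tgrad_bound t0 times(2,3) by simp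
  have hess_pos: "\<mu> * (norm v)\<^sup>2 \<le> (hess i u (t k) *v v) \<bullet> v" for i u k v
    by (rule strongly_monotone_derivative[OF _ hess[OF t0]]) (use cost[of k] in \<open>simp add: strong_costs_def\<close>)

  have bound: "limsup (\<lambda>k. ereal (norm (w k - wstar k)))
      \<le> ereal (eta0 dM \<mu> C\<^sub>0 Ts \<rho> NP NC \<epsilon> / (1 - eta1 dM \<mu> \<rho> NP NC \<epsilon>) + C)"
    if \<epsilon>: "\<epsilon> \<in> Eps" and small: "c = 0 \<or> \<epsilon> * M \<le> c" and \<rho>: "\<rho> > 0"
      and \<eta>: "eta1 dM \<mu> \<rho> NP NC \<epsilon> < 1"
      and alg: "pc_dr_admm G f grad hess tgrad t Ts \<epsilon> \<rho> NP NC x0 x z w"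
    for \<epsilon> \<rho> NP NC x0 x z w
  proof -
    have \<epsilon>0: "\<epsilon> > 0"
      using \<epsilon> Eps_pos by auto
    have "\<forall>k. \<exists>p. saddle G \<epsilon> (\<lambda>i u. grad i u (t k)) (fst p) (snd p)"
      using saddle_exists[OF graph(1) cost \<epsilon>0] by (metis fst_conv snd_conv)
    then obtain WX where WX: "\<And>k. saddle G \<epsilon> (\<lambda>i u. grad i u (t k)) (fst (WX k)) (snd (WX k))"
      by metis
    define W X where "W k = fst (WX k)" and "X k = snd (WX k)" for k
    have sad: "saddle G \<epsilon> (\<lambda>i u. grad i u (t k)) (W k) (X k)" for k
      using WX by (simp add: W_def X_def)
    have WC: "norm (W k) \<le> C" "norm (W k - wstar k) \<le> C" for k
    proof -
      have "reg_dual_solution G f \<epsilon> (t k) = W k"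
        by (rule reg_dual_solution_saddle[of G \<mu> f "t k", OF graph(1) cost sad \<epsilon>0])
      then show "norm (W k) \<le> C"
        using C_bound[OF \<epsilon>, of k] by simp
      show "norm (W k - wstar k) \<le> C"
        using dual_solution_saddle_dist[of G \<mu> f "t k", OF graph(1) cost sad \<epsilon>0 wstar]
          C_bound[OF \<epsilon>, of k] by simp
    qed

    obtain fhat where fhat: "\<And>k. predicted_costs grad hess tgrad Ts (t k) (x k) (fhat k)"
      and z_Suc: "\<And>k. z (Suc k) = (admm_step G \<epsilon> \<rho> (\<lambda>i u. f i u (t (Suc k))) ^^ NC)
          ((admm_step G \<epsilon> \<rho> (fhat k) ^^ NP) (z k))"
      and x_Suc: "\<And>k. x (Suc k) = (\<chi> i. local_argmin G \<epsilon> \<rho> (\<lambda>i u. f i u (t (Suc k))) (z (Suc k)) i)"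
      and z_0: "z 0 = 0"
      and w: "\<And>k. w k = delta \<epsilon> \<rho> *\<^sub>R (z k - \<rho> *\<^sub>R A_map G (x k))"
      using alg unfolding pc_dr_admm_def by metis
    have z: "z k \<in> edge_space G" for k
      by (induction k)
        (auto simp: z_0 z_Suc subspace_0[OF subspace_edge_space] intro!: admm_iterate_in_edge_space)
    have wz: "z k = prox_argument G \<epsilon> \<rho> (w k) (x k)" for k
      using w delta_prox_argument[OF \<epsilon>0 \<rho>] by blast
    \<comment> \<open>Only successor indices are covered, since \<open>x 0\<close> is prescribed
      rather than computed from \<open>z 0\<close>.\<close>
    have wx: "dual_point G (\<lambda>i u. grad i u (t (Suc k))) (w (Suc k)) (x (Suc k))" for k
      by (rule local_argmin_dual_point[OF cost \<epsilon>0 \<rho> z x_Suc w])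

    define q where "q = c / \<epsilon>"
    have q: "q = C0_bar dM \<mu> C\<^sub>0 * Ts / mu_bar \<epsilon>" "0 \<le> q"
      using c0 \<epsilon>0 by (simp_all add: q_def c_def mu_bar_def)
    have step: "norm (w (Suc k) - W (Suc k))
        \<le> eta1 dM \<mu> \<rho> NP NC \<epsilon> * norm (w k - W k) + eta0 dM \<mu> C\<^sub>0 Ts \<rho> NP NC \<epsilon>" if k: "k \<ge> 1" for k
    proof -
      obtain k' where k': "k = Suc k'"
        using k by (cases k) auto
      have wxk: "dual_point G (\<lambda>i u. grad i u (t k)) (w k) (x k)"
        using wx k' by simp
      have W_mem: "W k \<in> edge_space G"
        using sad by (simp add: saddle_def dual_point_def)
      define ghat where "ghat = (\<lambda>i u. grad i (x k $ i) (t k) + hess i (x k $ i) (t k) *v (u - x k $ i)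
          + Ts *\<^sub>R tgrad i (x k $ i) (t k))"
      have cost_hat: "strong_costs \<mu> (fhat k) ghat"
        unfolding ghat_def by (rule predicted_costs_strong[OF fhat constants(1) hess_pos])
      obtain y where y: "dual_point G (\<lambda>i u. grad i u (t (Suc k))) (W k) y"
        using dual_point_exists[OF cost W_mem] .
      have y_drift: "norm (A_map G (y - X k)) \<le> a"
        using norm_A_map_drift[OF cost y, of "\<lambda>i u. grad i u (t k)" "X k" "C\<^sub>0 * Ts"] sad drift
        by (simp add: saddle_def a_def c_def C0_bar_def dM_def)
      obtain xh where xh: "dual_point G ghat (w k) xh"
        using dual_point_exists[OF cost_hat] wxk by (auto simp: dual_point_def)
      \<comment> \<open>At \<open>x k\<close> the Hessian term vanishes, so predicted and old
        gradients differ exactly by the time-derivative term.\<close>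
      have "norm (ghat i (x k $ i) - grad i (x k $ i) (t k)) \<le> C\<^sub>0 * Ts" for i
        using mult_left_mono[OF tgrad_bound[OF t0], of Ts] times(2)
        by (simp add: ghat_def mult.commute)
      then have xh_drift: "norm (A_map G (xh - x k)) \<le> a"
        using norm_A_map_drift[OF cost_hat xh wxk, of "C\<^sub>0 * Ts"]
        by (simp add: a_def c_def C0_bar_def dM_def)
      define s where "s = norm (W (Suc k) - W k)"
      \<comment> \<open>The first bound, free of \<epsilon>, serves the case of positive
        \<open>c\<close>; the second forces \<open>s = 0\<close> when \<open>c = 0\<close>.\<close>
      have s: "s \<le> 2 * C" "s \<le> a / \<epsilon>"
      proof -
        show "s \<le> 2 * C"
          using norm_triangle_ineq4[of "W (Suc k)" "W k"] WC(1)[of k] WC(1)[of "Suc k"] by (simp add: s_def)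
        have "s \<le> norm (A_map G (y - X k)) / \<epsilon>"
          unfolding s_def by (rule saddle_perturbation(1)[OF cost \<epsilon>0 \<rho> sad sad y])
        also have "\<dots> \<le> a / \<epsilon>"
          using y_drift \<epsilon>0 by (simp add: divide_right_mono)
        finally show "s \<le> a / \<epsilon>" .
      qed
      have sq: "s + a / L_bar dM \<mu> \<epsilon> \<le> q" "2 * \<beta> * s + 2 * a \<le> q * \<beta>"
      proof -
        have "s + a / L_bar dM \<mu> \<epsilon> \<le> q \<and> 2 * \<beta> * s + 2 * a \<le> q * \<beta>"
        proof (cases "c = 0")
          case True
          then have "a = 0" "q = 0"
            by (simp_all add: a_def q_def)
          moreover have "s = 0"
            using s(2) \<open>a = 0\<close> by (simp add: s_def)
          ultimately show ?thesis
            by simp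
        next
          case False
          then have \<beta>: "\<beta> > 0"
            using \<beta>0 constants(1) by (auto simp: c_def C0_bar_def \<beta>_def)
          have Mq: "M \<le> q"
            using small False \<epsilon>0 by (simp add: q_def field_simps)
          have Lb: "0 < L_bar dM \<mu> \<epsilon>" "\<beta> \<le> L_bar dM \<mu> \<epsilon>"
            using L_bar_bounds[OF constants(1) \<epsilon>0, of dM] by (simp_all add: \<beta>_def)
          have "0 \<le> s"
            by (simp add: s_def)
          have "a / L_bar dM \<mu> \<epsilon> \<le> a / \<beta>"
            using a0 \<beta> Lb by (intro divide_left_mono) auto
          moreover have "0 \<le> a / \<beta>"
            using a0 \<beta> by simp
          ultimately have "s + a / L_bar dM \<mu> \<epsilon> \<le> M"
            using s(1) \<open>0 \<le> s\<close> by (simp add: M_def)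
          moreover have "2 * \<beta> * s + 2 * a \<le> q * \<beta>"
          proof -
            have "2 * \<beta> * s + 2 * a = (2 * s + 2 * (a / \<beta>)) * \<beta>"
              using \<beta> by (simp add: distrib_right)
            also have "\<dots> \<le> q * \<beta>"
              using s(1) Mq \<beta> by (intro mult_right_mono) (auto simp: M_def)
            finally show ?thesis .
          qed
          ultimately show ?thesis
            using Mq by simp
        qed
        then show "s + a / L_bar dM \<mu> \<epsilon> \<le> q" "2 * \<beta> * s + 2 * a \<le> q * \<beta>"
          by auto
      qed
      have "NC > 0"
        by (rule eta1_less_one_imp_correction[OF constants(1) \<rho> \<epsilon>0 \<eta>])
      have z_new: "prox_argument G \<epsilon> \<rho> (w (Suc k)) (x (Suc k))
          = (admm_step G \<epsilon> \<rho> (\<lambda>i u. f i u (t (Suc k))) ^^ NC)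
            ((admm_step G \<epsilon> \<rho> (fhat k) ^^ NP) (prox_argument G \<epsilon> \<rho> (w k) (x k)))"
        using z_Suc[of k] unfolding wz .
      show ?thesis
        by (rule admm_error_le_eta[OF constants(1) \<rho> \<epsilon>0 \<open>NC > 0\<close> norm_ge_zero q])
          (use prediction_correction_error[OF graph(1) \<epsilon>0 \<rho> cost cost cost_hat wxk sad sad y y_drift
            xh xh_drift order_refl sq[unfolded s_def dM_def \<beta>_def] wx z_new] in \<open>simp only: dM_def\<close>)
    qed
    show ?thesis
    proof (rule limsup_linear_recursion[where e = "\<lambda>k. norm (w k - W k)"])
      show "norm (w k - wstar k) \<le> norm (w k - W k) + C" for k
        using norm_triangle_ineq[of "w k - W k" "W k - wstar k"] WC(2)[of k] by simp
    qed (use step \<eta> eta1_nonneg[OF constants(1) \<rho> \<epsilon>0] in auto)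
  qed

  have "\<forall>\<^sub>F \<epsilon> in at_right 0. c = 0 \<or> \<epsilon> * M \<le> c"
  proof (cases "c = 0")
    case False
    have "((\<lambda>\<epsilon>. \<epsilon> * M) \<longlongrightarrow> 0 * M) (at_right 0)"
      by (intro tendsto_intros)
    then have "\<forall>\<^sub>F \<epsilon> in at_right 0. \<epsilon> * M < c"
      using False c0 by (intro order_tendstoD(2)) auto
    then show ?thesis
      by (rule eventually_mono) simp
  qed simp
  moreover have "\<forall>\<^sub>F \<epsilon> in at_right 0. (0 :: real) < \<epsilon>"
    by (rule eventually_at_right_less)
  ultimately have "\<forall>\<^sub>F \<epsilon> in at_right 0. \<epsilon> \<in> Eps \<longrightarrow>
    (\<forall>\<rho> N\<^sub>P N\<^sub>C x0 x z w.
       \<rho> > 0 \<longrightarrow>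
       eta1 (max_degree G) \<mu> \<rho> N\<^sub>P N\<^sub>C \<epsilon> < 1 \<longrightarrow>
       pc_dr_admm G f grad hess tgrad t Ts \<epsilon> \<rho> N\<^sub>P N\<^sub>C x0 x z w \<longrightarrow>
       limsup (\<lambda>k. ereal (norm (w k - wstar k)))
         \<le> ereal (eta0 (max_degree G) \<mu> C\<^sub>0 Ts \<rho> N\<^sub>P N\<^sub>C \<epsilon>
                    / (1 - eta1 (max_degree G) \<mu> \<rho> N\<^sub>P N\<^sub>C \<epsilon>)
                  + C * (1 + 1 * \<epsilon>)))"
  proof (rule eventually_elim2, intro impI allI)
    fix \<epsilon> \<rho> :: real and NP NC x0 x z w
    assume small: "c = 0 \<or> \<epsilon> * M \<le> c" and "0 < \<epsilon>" and \<epsilon>: "\<epsilon> \<in> Eps" and \<rho>: "\<rho> > 0"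
      and \<eta>: "eta1 (max_degree G) \<mu> \<rho> NP NC \<epsilon> < 1"
      and alg: "pc_dr_admm G f grad hess tgrad t Ts \<epsilon> \<rho> NP NC x0 x z w"
    \<comment> \<open>Nonnegativity follows from the solution bound at an admissible \<epsilon> and
      allows weakening \<open>C\<close> to the stated expression with \<open>1\<close> as
      witness.\<close>
    have "0 \<le> C"
      using C_bound[OF \<epsilon>, of 0] norm_ge_zero[of "wstar 0"] by linarith
    then have "C \<le> C * (1 + 1 * \<epsilon>)"
      using \<open>0 < \<epsilon>\<close> by (simp add: algebra_simps)
    then show "limsup (\<lambda>k. ereal (norm (w k - wstar k)))
         \<le> ereal (eta0 (max_degree G) \<mu> C\<^sub>0 Ts \<rho> NP NC \<epsilon>
                    / (1 - eta1 (max_degree G) \<mu> \<rho> NP NC \<epsilon>)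
                  + C * (1 + 1 * \<epsilon>))"
      by (intro order_trans[OF bound[unfolded dM_def, OF \<epsilon> small \<rho> \<eta> alg]]) simp
  qed
  then show ?thesis
    by (intro exI[of _ 1] conjI) simp_all
qed

end
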